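(* Let $P$ be a Markov kernel on a measurable space $(\mathbb X,\mathcal X)$ and $V:\mathbb X\to[1,+\infty)$ measurable. Assume that $P$ satisfies the following drift/minorization conditions: there exist a bounded set $S\in\mathcal X$ and a positive measure $\nu$ on $(\mathbb X,\mathcal X)$ such that $$\exists\,\delta\in(0,1),\ \exists L>0,\quad PV\le\delta\,V+L\,1_S,$$ $$\forall x\in\mathbb X,\ \forall A\in\mathcal X,\quad P(x,A)\ge\nu(1_A)\,1_S(x).$$ Then $P$ is a power-bounded quasi-compact operator on $\mathcal B_1$ with $$r_{ess}(P)\le\frac{\delta\,\nu(1_{\mathbb X})+\tau}{\nu(1_{\mathbb X})+\tau},\qquad\text{where }\tau:=\max(0,L-\nu(V)).$$
   Context: $V$ satisfies $V(x_0)=1$ for some $x_0\in\mathbb X$. $\mathcal B_1$ is the Banach space of measurable $f:\mathbb X\to\mathbb C$ with $\|f\|_1:=\sup_{x\in\mathbb X}|f(x)|/V(x)<\infty$, and $P$ acts on it by $(Pf)(x)=\int f(y)P(x,dy)$; $PV/V$ is assumed bounded, so $P$ is a bounded operator on $\mathcal B_1$. It is also a standing assumption that $P$ has an invariant probability measure $\pi$ with $\pi(V)<\infty$. For a measure $\mu$, $\mu(f):=\int f\,d\mu$; $1_A$ is the indicator function of $A$. "Positive measure" means a nonnegative measure that is not identically zero, i.e. $\nu(1_{\mathbb X})>0$. "Bounded set" is a hypothesis on $S$ in the source, which does not specify the notion of boundedness on the general space $\mathbb X$; it is to be read with respect to whatever notion of boundedness $\mathbb X$ carries. Power-bounded means $\sup_{n\ge0}\|P^n\|_1<\infty$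 (operator norm on $\mathcal B_1$). For a bounded operator $T$ on a Banach space, the essential spectral radius is $r_{ess}(T):=\lim_n(\inf_K\|T^n-K\|)^{1/n}$, the infimum being over compact operators $K$; for $T$ of spectral radius $1$, $T$ is quasi-compact if $r_{ess}(T)<1$ (equivalently, for some $n_0\ge1$ and some compact $K_0$ the operator $T^{n_0}-K_0$ has spectral radius $<1$). *)

theory Defs
  imports "HOL-Probability.Probability"
begin

text \<open>
  A notion of boundedness on a set \<open>X\<close>: a bornology, i.e. a family of subsets of \<open>X\<close> that covers
  \<open>X\<close> and is closed under subsets and finite unions. The metrically bounded subsets of a metric
  space are an instance, and so is the family of all subsets.
\<close>

definition bornology_on :: "'a set \<Rightarrow> 'a set set \<Rightarrow> bool" where
  "bornology_on X \<B> \<longleftrightarrow>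
     \<B> \<subseteq> Pow X \<and> \<Union>\<B> = X \<and> {} \<in> \<B> \<and>
     (\<forall>A\<in>\<B>. \<forall>B. B \<subseteq> A \<longrightarrow> B \<in> \<B>) \<and>
     (\<forall>A\<in>\<B>. \<forall>B\<in>\<B>. A \<union> B \<in> \<B>)"

text \<open>
  Functions on \<open>space M\<close> are represented by functions on the whole type that vanish outside
  \<open>space M\<close>, so that \<open>wnorm\<close> separates points. The supremum in \<open>wnorm\<close> presupposes that
  \<open>space M\<close> is nonempty.
\<close>

definition wspace :: "'a measure \<Rightarrow> ('a \<Rightarrow> real) \<Rightarrow> ('a \<Rightarrow> complex) set" where
  "wspace M V = {f \<in> borel_measurable M.
     (\<forall>x. x \<notin> space M \<longrightarrow> f x = 0) \<and> bdd_above ((\<lambda>x. norm (f x) / V x) ` space M)}"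

definition wnorm :: "'a measure \<Rightarrow> ('a \<Rightarrow> real) \<Rightarrow> ('a \<Rightarrow> complex) \<Rightarrow> real" where
  "wnorm M V f = (SUP x\<in>space M. norm (f x) / V x)"

text \<open>
  Operators are functions on the whole type of functions; only their values on \<open>wspace M V\<close> matter.
\<close>

type_synonym 'a operator = "('a \<Rightarrow> complex) \<Rightarrow> ('a \<Rightarrow> complex)"

definition kernel_operator :: "'a measure \<Rightarrow> ('a \<Rightarrow> 'a measure) \<Rightarrow> 'a operator" where
  "kernel_operator M P f = (\<lambda>x. if x \<in> space M then (\<integral>y. f y \<partial>P x) else 0)"

definition bounded_operator :: "'a measure \<Rightarrow> ('a \<Rightarrow> real) \<Rightarrow> 'a operator \<Rightarrow> bool" where
  "bounded_operator M V T \<longleftrightarrow>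
     (\<forall>f\<in>wspace M V. T f \<in> wspace M V) \<and>
     (\<forall>f\<in>wspace M V. \<forall>g\<in>wspace M V. T (\<lambda>x. f x + g x) = (\<lambda>x. T f x + T g x)) \<and>
     (\<forall>c. \<forall>f\<in>wspace M V. T (\<lambda>x. c * f x) = (\<lambda>x. c * T f x)) \<and>
     (\<exists>C. \<forall>f\<in>wspace M V. wnorm M V (T f) \<le> C * wnorm M V f)"

text \<open>A genuine supremum only for operators satisfying \<^const>\<open>bounded_operator\<close>.\<close>

definition operator_norm :: "'a measure \<Rightarrow> ('a \<Rightarrow> real) \<Rightarrow> 'a operator \<Rightarrow> real" where
  "operator_norm M V T = (SUP f\<in>{f \<in> wspace M V. wnorm M V f \<le> 1}. wnorm M V (T f))"

definition compact_operator :: "'a measure \<Rightarrow> ('a \<Rightarrow> real) \<Rightarrow> 'a operator \<Rightarrow> bool" where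
  "compact_operator M V K \<longleftrightarrow>
     bounded_operator M V K \<and>
     (\<forall>f :: nat \<Rightarrow> 'a \<Rightarrow> complex.
        (\<forall>n. f n \<in> wspace M V) \<and> bdd_above (range (\<lambda>n. wnorm M V (f n))) \<longrightarrow>
        (\<exists>r g. strict_mono r \<and> g \<in> wspace M V \<and>
           (\<lambda>n. wnorm M V (\<lambda>x. K (f (r n)) x - g x)) \<longlonglongrightarrow> 0))"

definition power_bounded :: "'a measure \<Rightarrow> ('a \<Rightarrow> real) \<Rightarrow> 'a operator \<Rightarrow> bool" where
  "power_bounded M V T \<longleftrightarrow>
     bounded_operator M V T \<and> bdd_above (range (\<lambda>n. operator_norm M V (T ^^ n)))"

definition op_spectrum :: "'a measure \<Rightarrow> ('a \<Rightarrow> real) \<Rightarrow> 'a operator \<Rightarrow> complex set" where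
  "op_spectrum M V T = {z. \<not> (\<exists>R. bounded_operator M V R \<and>
     (\<forall>f\<in>wspace M V. R (\<lambda>x. z * f x - T f x) = f \<and> (\<lambda>x. z * R f x - T (R f) x) = f))}"

definition op_spectral_radius :: "'a measure \<Rightarrow> ('a \<Rightarrow> real) \<Rightarrow> 'a operator \<Rightarrow> real" where
  "op_spectral_radius M V T = (SUP z\<in>op_spectrum M V T. norm z)"

definition ess_spectral_radius :: "'a measure \<Rightarrow> ('a \<Rightarrow> real) \<Rightarrow> 'a operator \<Rightarrow> real" where
  "ess_spectral_radius M V T =
     lim (\<lambda>n. root n (INF K\<in>Collect (compact_operator M V).
                         operator_norm M V (\<lambda>f x. (T ^^ n) f x - K f x)))"

text \<open>
  Quasi-compactness is used only for operators of spectral radius 1; this normalisation is made part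
  of the notion.
\<close>

definition quasi_compact :: "'a measure \<Rightarrow> ('a \<Rightarrow> real) \<Rightarrow> 'a operator \<Rightarrow> bool" where
  "quasi_compact M V T \<longleftrightarrow>
     bounded_operator M V T \<and> op_spectral_radius M V T = 1 \<and> ess_spectral_radius M V T < 1"

end

theory Submission
  imports Defs
begin

text \<open>
  Write \<open>P = R + \<nu>(\<cdot>) 1\<^sub>S\<close>. The minorization says that the residual kernel \<open>R\<close> is still nonnegative,
  and \<open>P ^^ n - R ^^ n\<close> is compact because \<open>P - R\<close> has rank one. Hence \<open>R ^^ n\<close> bounds the distance
  of \<open>P ^^ n\<close> to the compact operators, and the essential spectral radius is at most the growth
  rate of the norm of \<open>R ^^ n\<close>.

  This growth rate is read off from a modified weight. The drift condition gives
  \<open>R V \<le> \<delta> V + (L - \<nu>(V)) 1\<^sub>S\<close>, which yields the factor \<open>\<delta>\<close> on \<open>S\<close> only if \<open>L \<le> \<nu>(V)\<close>. On the other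
  hand \<open>R 1 = 1 - \<nu>(1) 1\<^sub>S\<close>: on \<open>S\<close> the residual kernel loses the mass \<open>\<nu>(1)\<close>. Adding to \<open>V\<close> the
  constant \<open>c = \<tau> / \<nu>(1)\<close> makes this loss compensate exactly the excess \<open>\<tau>\<close>, so that
  \<open>R (V + c) \<le> \<delta> V + c\<close> everywhere. Since \<open>(\<delta> v + c) / (v + c)\<close> is nonincreasing in \<open>v \<ge> 1\<close>, this is at
  most \<open>(\<delta> + c) / (1 + c)\<close> times \<open>V + c\<close>, and that factor is the claimed bound
  (\<open>residual_norm_le\<close>). It is below \<open>1\<close>, which is quasi-compactness once the spectral radius is
  known. The weights \<open>V\<close> and \<open>V + c\<close> are equivalent, so the rate is the same for the norm of \<open>V\<close>.

  The remaining points are of a general nature. The essential spectral radius is a limit, whose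
  existence follows from Fekete's lemma: the compact operators form an ideal, so the distance to
  them is submultiplicative (\<open>compact_distance_comp_le\<close>). Power-boundedness is the iterated drift
  condition. The spectral radius is \<open>1\<close> because \<open>P 1 = 1\<close> and because the Neumann series converges
  outside the closed unit disc (\<open>power_bounded_spectrum\<close>).

  The invariant measure ensures that \<open>S\<close> is not empty: otherwise \<open>\<pi>(V) = \<pi>(P V) \<le> \<delta> \<pi>(V)\<close>, which
  contradicts \<open>1 \<le> \<pi>(V) < \<infinity>\<close>. A point \<open>x\<close> of \<open>S\<close> then gives \<open>\<nu> \<le> P x\<close>, so that \<open>\<nu>(1)\<close> and
  \<open>\<nu>(V)\<close> are finite.
\<close>

section \<open>Submultiplicative sequences\<close>

lemma le_cInf_mult:
  fixes A :: "real set"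
  assumes "A \<noteq> {}" "0 \<le> b" "\<And>a. a \<in> A \<Longrightarrow> x \<le> a * b"
  shows "x \<le> Inf A * b"
proof (cases "b = 0")
  case True
  then show ?thesis using assms by auto
next
  case False
  then have b: "b > 0" using assms by simp
  have "x / b \<le> Inf A"
    using assms b by (intro cInf_greatest) (auto simp: pos_divide_le_eq)
  then show ?thesis using b by (simp add: pos_divide_le_eq)
qed

lemma submultiplicative_power_le:
  fixes a :: "nat \<Rightarrow> real"
  assumes nonneg: "\<And>n. 0 \<le> a n" and submult: "\<And>m n. a (m + n) \<le> a m * a n"
  shows "a (q * m + r) \<le> a m ^ q * a r"
proof (induction q)
  case (Suc q)
  have "a (Suc q * m + r) \<le> a m * a (q * m + r)"
    using submult[of m "q * m + r"] by (simp add: ac_simps)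
  also have "\<dots> \<le> a m * (a m ^ q * a r)"
    using Suc nonneg by (intro mult_left_mono) auto
  finally show ?case by simp
qed simp

text \<open>
  This is Fekete's lemma. The limit is the infimum \<open>l\<close> of the roots over \<open>n \<ge> 1\<close>: if \<open>root m (a m) < b\<close>
  for one \<open>m\<close>, then \<open>a n\<close> is at most a constant times \<open>b ^ n\<close> for all \<open>n\<close>, and the \<open>n\<close>-th root of
  the constant tends to \<open>1\<close>.
\<close>

lemma submultiplicative_root_convergent:
  fixes a :: "nat \<Rightarrow> real"
  assumes nonneg: "\<And>n. 0 \<le> a n" and submult: "\<And>m n. a (m + n) \<le> a m * a n"
  shows "convergent (\<lambda>n. root n (a n))"
proof -
  define l where "l = (INF n\<in>{1..}. root n (a n))"
  have bdd: "bdd_below ((\<lambda>n. root n (a n)) ` {1..})"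
    by (rule bdd_belowI2[where m = 0]) (auto intro!: real_root_ge_zero nonneg)
  have l_le: "l \<le> root n (a n)" if "n \<ge> 1" for n
    unfolding l_def using that by (intro cINF_lower bdd) auto
  have l0: "0 \<le> l"
    unfolding l_def by (rule cINF_greatest) (auto intro!: real_root_ge_zero nonneg)
  have "(\<lambda>n. root n (a n)) \<longlonglongrightarrow> l"
  proof (rule order_tendstoI)
    fix y assume "y < l"
    then show "\<forall>\<^sub>F n in sequentially. y < root n (a n)"
      using l_le by (intro eventually_sequentiallyI[of 1]) (auto intro: less_le_trans)
  next
    fix y assume "l < y"
    obtain b where b: "l < b" "b < y" using dense[OF \<open>l < y\<close>] by auto
    then have b0: "b > 0" using l0 by simp
    obtain m where m: "m \<ge> 1" "root m (a m) < b"
      using cInf_lessD[of "(\<lambda>n. root n (a n)) ` {1..}" b] b(1) unfolding l_def by auto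
    have am: "a m \<le> b ^ m"
    proof -
      have "a m = root m (a m) ^ m" using m(1) nonneg by (simp add: real_root_pow_pos2)
      also have "\<dots> \<le> b ^ m"
        using m nonneg by (intro power_mono) (auto intro: real_root_ge_zero)
      finally show ?thesis .
    qed
    define C where "C = (\<Sum>r<m. a r / b ^ r) + 1"
    have C0: "C > 0" unfolding C_def
      using nonneg b0 by (intro add_nonneg_pos sum_nonneg) auto
    \<comment> \<open>Division with remainder by \<open>m\<close> turns the bound on \<open>a m\<close> into one on all \<open>a n\<close>.\<close>
    have an: "a n \<le> C * b ^ n" for n
    proof -
      let ?q = "n div m" and ?r = "n mod m"
      have r: "?r < m" using m by simp
      have bn: "b ^ n = b ^ (m * ?q) * b ^ ?r"
        using power_add[of b "m * ?q" ?r] by simp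
      have "a n = a (?q * m + ?r)" by simp
      also have "\<dots> \<le> a m ^ ?q * a ?r"
        by (rule submultiplicative_power_le) (fact nonneg submult)+
      also have "\<dots> \<le> (b ^ m) ^ ?q * a ?r"
        using am nonneg by (intro mult_right_mono power_mono) auto
      also have "\<dots> = b ^ n * (a ?r / b ^ ?r)"
        using b0 by (simp add: bn power_mult)
      also have "a ?r / b ^ ?r \<le> (\<Sum>r<m. a r / b ^ r)"
        using r nonneg b0 by (intro member_le_sum) auto
      also have "(\<Sum>r<m. a r / b ^ r) \<le> C" unfolding C_def by simp
      finally show ?thesis using b0 by (simp add: mult.commute)
    qed
    have "(\<lambda>n. root n C * b) \<longlonglongrightarrow> 1 * b"
      by (intro tendsto_intros LIMSEQ_root_const C0)
    then have "\<forall>\<^sub>F n in sequentially. root n C * b < y"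
      using b(2) by (intro order_tendstoD(2)) auto
    then show "\<forall>\<^sub>F n in sequentially. root n (a n) < y"
      using eventually_ge_at_top[of 1]
    proof eventually_elim
      case (elim n)
      have "root n (a n) \<le> root n (C * b ^ n)" using elim an by simp
      also have "\<dots> = root n C * b" using elim b0 by (simp add: real_root_mult real_root_power_cancel)
      finally show ?case using elim by simp
    qed
  qed
  then show ?thesis by (rule convergentI)
qed

section \<open>The weighted supremum norm\<close>

locale weighted_space =
  fixes M :: "'a measure" and V :: "'a \<Rightarrow> real"
  assumes V_meas [measurable]: "V \<in> borel_measurable M"
    and V_ge_1: "\<And>x. x \<in> space M \<Longrightarrow> 1 \<le> V x"
    and space_nonempty: "space M \<noteq> {}"
begin

lemma V_pos: "x \<in> space M \<Longrightarrow> 0 < V x"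
  using V_ge_1[of x] by linarith

lemma wspaceI:
  assumes "f \<in> borel_measurable M" "\<And>x. x \<notin> space M \<Longrightarrow> f x = 0"
    and "\<And>x. x \<in> space M \<Longrightarrow> norm (f x) \<le> a * V x"
  shows "f \<in> wspace M V"
  unfolding wspace_def using assms V_pos
  by (auto intro!: bdd_aboveI2[where M = a] simp: pos_divide_le_eq)

lemma wspace_measurable [measurable_dest]: "f \<in> wspace M V \<Longrightarrow> f \<in> borel_measurable M"
  by (simp add: wspace_def)

lemma wspace_outside: "f \<in> wspace M V \<Longrightarrow> x \<notin> space M \<Longrightarrow> f x = 0"
  by (simp add: wspace_def)

lemma wnorm_le:
  assumes "\<And>x. x \<in> space M \<Longrightarrow> norm (f x) \<le> a * V x"
  shows "wnorm M V f \<le> a"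
  unfolding wnorm_def using assms V_pos space_nonempty
  by (intro cSUP_least) (auto simp: pos_divide_le_eq)

lemma norm_le_wnorm:
  assumes "f \<in> wspace M V" "x \<in> space M"
  shows "norm (f x) \<le> wnorm M V f * V x"
proof -
  have "norm (f x) / V x \<le> wnorm M V f"
    unfolding wnorm_def using assms by (intro cSUP_upper) (auto simp: wspace_def)
  then show ?thesis using V_pos[OF assms(2)] by (simp add: pos_divide_le_eq)
qed

lemma wnorm_nonneg:
  assumes "f \<in> wspace M V"
  shows "0 \<le> wnorm M V f"
proof -
  obtain x where x: "x \<in> space M" using space_nonempty by auto
  have "0 \<le> wnorm M V f * V x"
    using norm_le_wnorm[OF assms x] norm_ge_zero order_trans by blast
  then show ?thesis using V_pos[OF x] by (simp add: zero_le_mult_iff)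
qed

lemma wnorm_eq_0D:
  assumes "f \<in> wspace M V" "wnorm M V f \<le> 0"
  shows "f = (\<lambda>x. 0)"
proof
  fix x show "f x = 0"
  proof (cases "x \<in> space M")
    case True
    have "norm (f x) \<le> 0 * V x"
      using norm_le_wnorm[OF assms(1) True] assms wnorm_nonneg[OF assms(1)] by simp
    then show ?thesis by simp
  qed (rule wspace_outside[OF assms(1)])
qed

lemma wspace_zero: "(\<lambda>x. 0) \<in> wspace M V"
  by (rule wspaceI[where a = 0]) auto

lemma norm_add_le:
  assumes "f \<in> wspace M V" "g \<in> wspace M V" "x \<in> space M"
  shows "norm (f x + g x) \<le> (wnorm M V f + wnorm M V g) * V x"
  using norm_le_wnorm[OF assms(1,3)] norm_le_wnorm[OF assms(2,3)]
  by (intro norm_triangle_le) (simp add: algebra_simps)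

lemma norm_scale_le:
  assumes "f \<in> wspace M V" "x \<in> space M"
  shows "norm (c * f x) \<le> (norm c * wnorm M V f) * V x"
  using mult_left_mono[OF norm_le_wnorm[OF assms], of "norm c"] by (simp add: norm_mult mult.assoc)

lemma wspace_add:
  assumes "f \<in> wspace M V" "g \<in> wspace M V"
  shows "(\<lambda>x. f x + g x) \<in> wspace M V"
  using assms by (intro wspaceI[OF _ _ norm_add_le[OF assms]]) (auto simp: wspace_outside)

lemma wspace_scale:
  assumes "f \<in> wspace M V"
  shows "(\<lambda>x. c * f x) \<in> wspace M V"
  using assms by (intro wspaceI[OF _ _ norm_scale_le[OF assms]]) (auto simp: wspace_outside)

lemma wnorm_add_le:
  assumes "f \<in> wspace M V" "g \<in> wspace M V"
  shows "wnorm M V (\<lambda>x. f x + g x) \<le> wnorm M V f + wnorm M V g"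
  by (intro wnorm_le norm_add_le assms)

lemma wnorm_scale_le:
  assumes "f \<in> wspace M V"
  shows "wnorm M V (\<lambda>x. c * f x) \<le> norm c * wnorm M V f"
  by (intro wnorm_le norm_scale_le assms)

lemma wspace_diff:
  assumes "f \<in> wspace M V" "g \<in> wspace M V"
  shows "(\<lambda>x. f x - g x) \<in> wspace M V"
  using wspace_add[OF assms(1) wspace_scale[OF assms(2), of "-1"]] by simp

lemma wnorm_diff_le:
  assumes "f \<in> wspace M V" "g \<in> wspace M V"
  shows "wnorm M V (\<lambda>x. f x - g x) \<le> wnorm M V f + wnorm M V g"
  using wnorm_add_le[OF assms(1) wspace_scale[OF assms(2), of "-1"]] wnorm_scale_le[OF assms(2), of "-1"]
  by simp

section \<open>Bounded operators\<close>

lemma bounded_operator_wspace: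
  "bounded_operator M V T \<Longrightarrow> f \<in> wspace M V \<Longrightarrow> T f \<in> wspace M V"
  by (simp add: bounded_operator_def)

lemma bounded_operator_add:
  "bounded_operator M V T \<Longrightarrow> f \<in> wspace M V \<Longrightarrow> g \<in> wspace M V \<Longrightarrow>
     T (\<lambda>x. f x + g x) = (\<lambda>x. T f x + T g x)"
  by (simp add: bounded_operator_def)

lemma bounded_operator_scale:
  "bounded_operator M V T \<Longrightarrow> f \<in> wspace M V \<Longrightarrow> T (\<lambda>x. c * f x) = (\<lambda>x. c * T f x)"
  by (simp add: bounded_operator_def)

lemma bounded_operator_diff:
  assumes "bounded_operator M V T" "f \<in> wspace M V" "g \<in> wspace M V"
  shows "T (\<lambda>x. f x - g x) = (\<lambda>x. T f x - T g x)"
  using bounded_operator_add[OF assms(1,2) wspace_scale[OF assms(3), of "-1"]]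
    bounded_operator_scale[OF assms(1,3), of "-1"] by simp

lemma bounded_operator_zero:
  assumes "bounded_operator M V T"
  shows "T (\<lambda>x. 0) = (\<lambda>x. 0)"
  using bounded_operator_scale[OF assms wspace_zero, of 0] by simp

lemma bounded_operatorI:
  assumes "\<And>f. f \<in> wspace M V \<Longrightarrow> T f \<in> wspace M V"
    and "\<And>f g x. f \<in> wspace M V \<Longrightarrow> g \<in> wspace M V \<Longrightarrow> T (\<lambda>x. f x + g x) x = T f x + T g x"
    and "\<And>c f x. f \<in> wspace M V \<Longrightarrow> T (\<lambda>x. c * f x) x = c * T f x"
    and "\<And>f. f \<in> wspace M V \<Longrightarrow> wnorm M V (T f) \<le> C * wnorm M V f"
  shows "bounded_operator M V T"
  unfolding bounded_operator_def using assms by blast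

lemma bounded_operatorE:
  assumes "bounded_operator M V T"
  obtains C where "0 \<le> C" "\<And>f. f \<in> wspace M V \<Longrightarrow> wnorm M V (T f) \<le> C * wnorm M V f"
proof -
  obtain C where C: "\<And>f. f \<in> wspace M V \<Longrightarrow> wnorm M V (T f) \<le> C * wnorm M V f"
    using assms unfolding bounded_operator_def by blast
  show ?thesis
  proof (rule that[of "max 0 C"])
    fix f assume f: "f \<in> wspace M V"
    show "wnorm M V (T f) \<le> max 0 C * wnorm M V f"
      using C[OF f] mult_right_mono[OF max.cobounded2 wnorm_nonneg[OF f], of C 0] by linarith
  qed simp
qed

lemma bounded_operator_id: "bounded_operator M V (\<lambda>f. f)"
  by (rule bounded_operatorI[where C = 1]) auto

lemma bounded_operator_comp:
  assumes A: "bounded_operator M V A" and B: "bounded_operator M V B"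
  shows "bounded_operator M V (\<lambda>f. A (B f))"
proof -
  obtain a where a: "0 \<le> a" "\<And>f. f \<in> wspace M V \<Longrightarrow> wnorm M V (A f) \<le> a * wnorm M V f"
    using bounded_operatorE[OF A] by blast
  obtain b where b: "0 \<le> b" "\<And>f. f \<in> wspace M V \<Longrightarrow> wnorm M V (B f) \<le> b * wnorm M V f"
    using bounded_operatorE[OF B] by blast
  show ?thesis
  proof (rule bounded_operatorI[where C = "a * b"])
    fix f assume f: "f \<in> wspace M V"
    have "wnorm M V (A (B f)) \<le> a * wnorm M V (B f)"
      by (intro a bounded_operator_wspace[OF B] f)
    also have "\<dots> \<le> a * (b * wnorm M V f)" by (intro mult_left_mono a b f)
    finally show "wnorm M V (A (B f)) \<le> a * b * wnorm M V f" by (simp add: mult.assoc)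
  qed (simp_all add: bounded_operator_wspace[OF A] bounded_operator_wspace[OF B]
      bounded_operator_add[OF A] bounded_operator_add[OF B]
      bounded_operator_scale[OF A] bounded_operator_scale[OF B])
qed

lemma bounded_operator_minus:
  assumes A: "bounded_operator M V A" and B: "bounded_operator M V B"
  shows "bounded_operator M V (\<lambda>f x. A f x - B f x)"
proof -
  obtain a where a: "0 \<le> a" "\<And>f. f \<in> wspace M V \<Longrightarrow> wnorm M V (A f) \<le> a * wnorm M V f"
    using bounded_operatorE[OF A] by blast
  obtain b where b: "0 \<le> b" "\<And>f. f \<in> wspace M V \<Longrightarrow> wnorm M V (B f) \<le> b * wnorm M V f"
    using bounded_operatorE[OF B] by blast
  show ?thesis
  proof (rule bounded_operatorI[where C = "a + b"])
    fix f assume f: "f \<in> wspace M V"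
    show "(\<lambda>x. A f x - B f x) \<in> wspace M V"
      by (intro wspace_diff bounded_operator_wspace[OF A] bounded_operator_wspace[OF B] f)
    show "wnorm M V (\<lambda>x. A f x - B f x) \<le> (a + b) * wnorm M V f"
      using wnorm_diff_le[OF bounded_operator_wspace[OF A f] bounded_operator_wspace[OF B f]]
        a(2)[OF f] b(2)[OF f] by (simp add: algebra_simps)
  qed (simp_all add: bounded_operator_add[OF A] bounded_operator_add[OF B]
      bounded_operator_scale[OF A] bounded_operator_scale[OF B] algebra_simps)
qed

lemma bounded_operator_power:
  assumes "bounded_operator M V T"
  shows "bounded_operator M V (T ^^ n)"
proof (induction n)
  case 0
  show ?case using bounded_operator_id by (simp add: id_def)
next
  case (Suc n)
  show ?case using bounded_operator_comp[OF assms Suc] by (simp add: comp_def)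
qed

lemma wnorm_le_operator_norm:
  assumes T: "bounded_operator M V T" and f: "f \<in> wspace M V"
  shows "wnorm M V (T f) \<le> operator_norm M V T * wnorm M V f"
proof -
  obtain C where C: "0 \<le> C" "\<And>f. f \<in> wspace M V \<Longrightarrow> wnorm M V (T f) \<le> C * wnorm M V f"
    using bounded_operatorE[OF T] by blast
  show ?thesis
  proof (cases "wnorm M V f = 0")
    case True
    then show ?thesis using C(2)[OF f] by simp
  next
    case False
    define w where "w = wnorm M V f"
    have w: "w > 0" using False wnorm_nonneg[OF f] by (simp add: w_def)
    define g where "g = (\<lambda>x. complex_of_real (1 / w) * f x)"
    have g: "g \<in> wspace M V" unfolding g_def by (rule wspace_scale[OF f])
    have f_eq: "f = (\<lambda>x. complex_of_real w * g x)" using w by (simp add: g_def)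
    have g1: "wnorm M V g \<le> 1"
      using wnorm_scale_le[OF f, of "complex_of_real (1 / w)"] w by (simp add: g_def w_def norm_divide)
    have "wnorm M V (T f) \<le> w * wnorm M V (T g)"
      using wnorm_scale_le[OF bounded_operator_wspace[OF T g], of "complex_of_real w"] w
      by (subst f_eq) (simp add: bounded_operator_scale[OF T g])
    also have "wnorm M V (T g) \<le> operator_norm M V T"
      unfolding operator_norm_def
    proof (rule cSUP_upper)
      show "bdd_above ((\<lambda>f. wnorm M V (T f)) ` {f \<in> wspace M V. wnorm M V f \<le> 1})"
        using C mult_left_mono[of _ 1 C]
        by (intro bdd_aboveI2[where M = C]) (fastforce intro: order_trans)
    qed (use g g1 in auto)
    finally show ?thesis using w by (simp add: w_def mult.commute)
  qed
qed

lemma operator_norm_le: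
  assumes "\<And>f. f \<in> wspace M V \<Longrightarrow> wnorm M V f \<le> 1 \<Longrightarrow> wnorm M V (T f) \<le> C"
  shows "operator_norm M V T \<le> C"
  unfolding operator_norm_def
proof (rule cSUP_least)
  have "wnorm M V (\<lambda>x. 0) \<le> 1" using V_ge_1 by (intro wnorm_le) force
  then show "{f \<in> wspace M V. wnorm M V f \<le> 1} \<noteq> {}" using wspace_zero by blast
qed (use assms in auto)

lemma operator_norm_nonneg:
  assumes T: "bounded_operator M V T"
  shows "0 \<le> operator_norm M V T"
proof -
  define u :: "'a \<Rightarrow> complex" where "u = indicator (space M)"
  have u: "u \<in> wspace M V"
    using V_ge_1 by (intro wspaceI[where a = 1]) (auto simp: u_def)
  have "0 \<le> operator_norm M V T * wnorm M V u"
    using wnorm_le_operator_norm[OF T u] wnorm_nonneg[OF bounded_operator_wspace[OF T u]] by linarith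
  moreover have "wnorm M V u > 0"
  proof (rule ccontr)
    assume "\<not> wnorm M V u > 0"
    then have "u = (\<lambda>x. 0)" by (intro wnorm_eq_0D u) auto
    then show False using space_nonempty by (auto simp: u_def fun_eq_iff indicator_def split: if_splits)
  qed
  ultimately show ?thesis by (simp add: zero_le_mult_iff)
qed

lemma operator_norm_cong:
  assumes "\<And>f. f \<in> wspace M V \<Longrightarrow> A f = B f"
  shows "operator_norm M V A = operator_norm M V B"
  unfolding operator_norm_def using assms by (intro SUP_cong) auto

lemma operator_norm_comp_le:
  assumes A: "bounded_operator M V A" and B: "bounded_operator M V B"
  shows "operator_norm M V (\<lambda>f. A (B f)) \<le> operator_norm M V A * operator_norm M V B"
proof (rule operator_norm_le)
  fix f assume f: "f \<in> wspace M V" "wnorm M V f \<le> 1"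
  have "wnorm M V (A (B f)) \<le> operator_norm M V A * wnorm M V (B f)"
    by (intro wnorm_le_operator_norm A bounded_operator_wspace[OF B] f)
  also have "wnorm M V (B f) \<le> operator_norm M V B * wnorm M V f"
    by (intro wnorm_le_operator_norm B f)
  also have "\<dots> \<le> operator_norm M V B"
    using mult_left_mono[OF f(2) operator_norm_nonneg[OF B]] by simp
  finally show "wnorm M V (A (B f)) \<le> operator_norm M V A * operator_norm M V B"
    using operator_norm_nonneg[OF A] by (simp add: mult_left_mono)
qed

section \<open>Compact operators\<close>

lemma compact_operator_bounded: "compact_operator M V K \<Longrightarrow> bounded_operator M V K"
  by (simp add: compact_operator_def)

lemma compact_operatorD:
  fixes f :: "nat \<Rightarrow> 'a \<Rightarrow> complex"
  assumes "compact_operator M V K" "\<And>n. f n \<in> wspace M V" "bdd_above (range (\<lambda>n. wnorm M V (f n)))"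
  shows "\<exists>r g. strict_mono r \<and> g \<in> wspace M V \<and>
    (\<lambda>n. wnorm M V (\<lambda>x. K (f (r n)) x - g x)) \<longlonglongrightarrow> 0"
  using assms unfolding compact_operator_def by blast

lemma compact_operatorI:
  assumes "bounded_operator M V K"
    and "\<And>f :: nat \<Rightarrow> 'a \<Rightarrow> complex. (\<And>n. f n \<in> wspace M V) \<Longrightarrow>
      bdd_above (range (\<lambda>n. wnorm M V (f n))) \<Longrightarrow>
      \<exists>r g. strict_mono r \<and> g \<in> wspace M V \<and>
        (\<lambda>n. wnorm M V (\<lambda>x. K (f (r n)) x - g x)) \<longlonglongrightarrow> 0"
  shows "compact_operator M V K"
  using assms unfolding compact_operator_def by blast

lemma compact_operator_cong:
  assumes K: "compact_operator M V K" and eq: "\<And>f. f \<in> wspace M V \<Longrightarrow> K' f = K f"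
  shows "compact_operator M V K'"
proof -
  have "bounded_operator M V K'"
    using compact_operator_bounded[OF K] unfolding bounded_operator_def
    by (simp add: eq wspace_add wspace_scale)
  then show ?thesis
    using K by (auto simp: compact_operator_def eq)
qed

lemma compact_operator_comp_left:
  assumes A: "bounded_operator M V A" and K: "compact_operator M V K"
  shows "compact_operator M V (\<lambda>f. A (K f))"
proof (rule compact_operatorI)
  note K' = compact_operator_bounded[OF K]
  show "bounded_operator M V (\<lambda>f. A (K f))" by (rule bounded_operator_comp[OF A K'])
  fix f :: "nat \<Rightarrow> 'a \<Rightarrow> complex"
  assume f: "\<And>n. f n \<in> wspace M V" "bdd_above (range (\<lambda>n. wnorm M V (f n)))"
  obtain r g where rg: "strict_mono (r :: nat \<Rightarrow> nat)" "g \<in> wspace M V"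
    "(\<lambda>n. wnorm M V (\<lambda>x. K (f (r n)) x - g x)) \<longlonglongrightarrow> 0"
    using compact_operatorD[OF K f] by blast
  have d: "(\<lambda>x. K (f (r n)) x - g x) \<in> wspace M V" for n
    by (intro wspace_diff bounded_operator_wspace[OF K'] f rg)
  have eq: "A (\<lambda>x. K (f (r n)) x - g x) = (\<lambda>x. A (K (f (r n))) x - A g x)" for n
    by (intro bounded_operator_diff[OF A] bounded_operator_wspace[OF K'] f rg)
  have "(\<lambda>n. wnorm M V (\<lambda>x. A (K (f (r n))) x - A g x)) \<longlonglongrightarrow> 0"
  proof (rule tendsto_sandwich[where f = "\<lambda>n. 0"])
    show "(\<lambda>n. operator_norm M V A * wnorm M V (\<lambda>x. K (f (r n)) x - g x)) \<longlonglongrightarrow> 0"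
      using tendsto_mult_right_zero[OF rg(3)] .
    show "\<forall>\<^sub>F n in sequentially. wnorm M V (\<lambda>x. A (K (f (r n))) x - A g x)
        \<le> operator_norm M V A * wnorm M V (\<lambda>x. K (f (r n)) x - g x)"
      using wnorm_le_operator_norm[OF A d] by (auto simp: eq)
    show "\<forall>\<^sub>F n in sequentially. 0 \<le> wnorm M V (\<lambda>x. A (K (f (r n))) x - A g x)"
      using wnorm_nonneg[OF bounded_operator_wspace[OF A d]] by (auto simp: eq)
  qed simp
  then show "\<exists>r g. strict_mono r \<and> g \<in> wspace M V \<and>
      (\<lambda>n. wnorm M V (\<lambda>x. A (K (f (r n))) x - g x)) \<longlonglongrightarrow> 0"
    using rg bounded_operator_wspace[OF A rg(2)] by blast
qed

lemma compact_operator_comp_right: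
  assumes K: "compact_operator M V K" and A: "bounded_operator M V A"
  shows "compact_operator M V (\<lambda>f. K (A f))"
proof (rule compact_operatorI)
  show "bounded_operator M V (\<lambda>f. K (A f))"
    by (rule bounded_operator_comp[OF compact_operator_bounded[OF K] A])
  fix f :: "nat \<Rightarrow> 'a \<Rightarrow> complex"
  assume f: "\<And>n. f n \<in> wspace M V" "bdd_above (range (\<lambda>n. wnorm M V (f n)))"
  then obtain B where B: "\<And>n. wnorm M V (f n) \<le> B" by (auto simp: bdd_above_def)
  have "wnorm M V (A (f n)) \<le> operator_norm M V A * B" for n
    using wnorm_le_operator_norm[OF A f(1)] mult_left_mono[OF B operator_norm_nonneg[OF A]]
    by (rule order_trans)
  then have "bdd_above (range (\<lambda>n. wnorm M V (A (f n))))" by (intro bdd_aboveI2)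
  then show "\<exists>r g. strict_mono r \<and> g \<in> wspace M V \<and>
      (\<lambda>n. wnorm M V (\<lambda>x. K (A (f (r n))) x - g x)) \<longlonglongrightarrow> 0"
    by (rule compact_operatorD[OF K bounded_operator_wspace[OF A f(1)]])
qed

lemma compact_operator_minus:
  assumes K: "compact_operator M V K" and K': "compact_operator M V K'"
  shows "compact_operator M V (\<lambda>f x. K f x - K' f x)"
proof (rule compact_operatorI)
  note bK = compact_operator_bounded[OF K] and bK' = compact_operator_bounded[OF K']
  show "bounded_operator M V (\<lambda>f x. K f x - K' f x)" by (rule bounded_operator_minus[OF bK bK'])
  fix f :: "nat \<Rightarrow> 'a \<Rightarrow> complex"
  assume f: "\<And>n. f n \<in> wspace M V" "bdd_above (range (\<lambda>n. wnorm M V (f n)))"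
  obtain r g where rg: "strict_mono (r :: nat \<Rightarrow> nat)" "g \<in> wspace M V"
    "(\<lambda>n. wnorm M V (\<lambda>x. K (f (r n)) x - g x)) \<longlonglongrightarrow> 0"
    using compact_operatorD[OF K f] by blast
  have "bdd_above (range (\<lambda>n. wnorm M V (f (r n))))"
    using f(2) by (rule bdd_above_mono) auto
  then obtain r' g' where rg': "strict_mono (r' :: nat \<Rightarrow> nat)" "g' \<in> wspace M V"
    "(\<lambda>n. wnorm M V (\<lambda>x. K' (f (r (r' n))) x - g' x)) \<longlonglongrightarrow> 0"
    using compact_operatorD[of K' "\<lambda>n. f (r n)", OF K' f(1)] by blast
  let ?s = "r \<circ> r'"
  have s: "strict_mono ?s" by (rule strict_mono_o[OF rg(1) rg'(1)])
  have l1: "(\<lambda>n. wnorm M V (\<lambda>x. K (f (?s n)) x - g x)) \<longlonglongrightarrow> 0"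
    using LIMSEQ_subseq_LIMSEQ[OF rg(3) rg'(1)] by (simp add: comp_def)
  have d1: "(\<lambda>x. K (f (?s n)) x - g x) \<in> wspace M V" for n
    by (intro wspace_diff bounded_operator_wspace[OF bK] f rg)
  have d2: "(\<lambda>x. K' (f (?s n)) x - g' x) \<in> wspace M V" for n
    by (intro wspace_diff bounded_operator_wspace[OF bK'] f rg')
  have eq: "(\<lambda>x. (K (f (?s n)) x - K' (f (?s n)) x) - (g x - g' x))
      = (\<lambda>x. (K (f (?s n)) x - g x) - (K' (f (?s n)) x - g' x))" for n
    by (simp add: algebra_simps)
  have "(\<lambda>n. wnorm M V (\<lambda>x. (K (f (?s n)) x - K' (f (?s n)) x) - (g x - g' x))) \<longlonglongrightarrow> 0"
  proof (rule tendsto_sandwich[where f = "\<lambda>n. 0"])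
    show "(\<lambda>n. wnorm M V (\<lambda>x. K (f (?s n)) x - g x) + wnorm M V (\<lambda>x. K' (f (?s n)) x - g' x))
        \<longlonglongrightarrow> 0"
      using tendsto_add[OF l1] rg'(3) by fastforce
    show "\<forall>\<^sub>F n in sequentially. wnorm M V (\<lambda>x. (K (f (?s n)) x - K' (f (?s n)) x) - (g x - g' x))
        \<le> wnorm M V (\<lambda>x. K (f (?s n)) x - g x) + wnorm M V (\<lambda>x. K' (f (?s n)) x - g' x)"
      unfolding eq by (intro always_eventually allI wnorm_diff_le d1 d2)
    show "\<forall>\<^sub>F n in sequentially.
        0 \<le> wnorm M V (\<lambda>x. (K (f (?s n)) x - K' (f (?s n)) x) - (g x - g' x))"
      unfolding eq by (intro always_eventually allI wnorm_nonneg wspace_diff[OF d1 d2])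
  qed simp
  then show "\<exists>r g. strict_mono r \<and> g \<in> wspace M V \<and>
      (\<lambda>n. wnorm M V (\<lambda>x. K (f (r n)) x - K' (f (r n)) x - g x)) \<longlonglongrightarrow> 0"
    using s wspace_diff[OF rg(2) rg'(2)] by blast
qed

text \<open>
  The scalars \<open>l (f n)\<close> are bounded, so Bolzano--Weierstrass provides the subsequence.
\<close>

lemma compact_operator_rank_one:
  assumes T: "bounded_operator M V T" and h: "h \<in> wspace M V"
    and eq: "\<And>f. f \<in> wspace M V \<Longrightarrow> T f = (\<lambda>x. l f * h x)"
    and l: "\<And>f. f \<in> wspace M V \<Longrightarrow> norm (l f) \<le> C * wnorm M V f"
  shows "compact_operator M V T"
proof (rule compact_operatorI[OF T])
  fix f :: "nat \<Rightarrow> 'a \<Rightarrow> complex"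
  assume f: "\<And>n. f n \<in> wspace M V" "bdd_above (range (\<lambda>n. wnorm M V (f n)))"
  then obtain B where B: "\<And>n. wnorm M V (f n) \<le> B" by (auto simp: bdd_above_def)
  have "norm (l (f n)) \<le> \<bar>C\<bar> * B" for n
  proof -
    have "norm (l (f n)) \<le> \<bar>C\<bar> * wnorm M V (f n)"
      using l[OF f(1)[of n]] mult_right_mono[OF abs_ge_self wnorm_nonneg[OF f(1)[of n]], of C]
      by linarith
    also have "\<dots> \<le> \<bar>C\<bar> * B" by (intro mult_left_mono B) auto
    finally show ?thesis .
  qed
  then have "bounded (range (\<lambda>n. l (f n)))" by (auto intro: boundedI)
  then obtain r c where r: "strict_mono (r :: nat \<Rightarrow> nat)" "((\<lambda>n. l (f n)) \<circ> r) \<longlonglongrightarrow> c"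
    using bounded_imp_convergent_subsequence by blast
  have "(\<lambda>n. wnorm M V (\<lambda>x. T (f (r n)) x - c * h x)) \<longlonglongrightarrow> 0"
  proof (rule tendsto_sandwich[where f = "\<lambda>n. 0"])
    have e: "(\<lambda>x. T (f (r n)) x - c * h x) = (\<lambda>x. (l (f (r n)) - c) * h x)" for n
      by (simp add: eq f algebra_simps)
    have "(\<lambda>n. norm (l (f (r n)) - c)) \<longlonglongrightarrow> 0"
      using r(2) by (simp add: comp_def LIM_zero tendsto_norm_zero)
    then show "(\<lambda>n. norm (l (f (r n)) - c) * wnorm M V h) \<longlonglongrightarrow> 0"
      by (rule tendsto_mult_left_zero)
    show "\<forall>\<^sub>F n in sequentially. wnorm M V (\<lambda>x. T (f (r n)) x - c * h x)
        \<le> norm (l (f (r n)) - c) * wnorm M V h"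
      unfolding e by (intro always_eventually allI wnorm_scale_le h)
    show "\<forall>\<^sub>F n in sequentially. 0 \<le> wnorm M V (\<lambda>x. T (f (r n)) x - c * h x)"
      unfolding e by (intro always_eventually allI wnorm_nonneg wspace_scale h)
  qed simp
  then show "\<exists>r g. strict_mono r \<and> g \<in> wspace M V \<and>
      (\<lambda>n. wnorm M V (\<lambda>x. T (f (r n)) x - g x)) \<longlonglongrightarrow> 0"
    using r(1) wspace_scale[OF h, of c] by blast
qed

lemma compact_operator_zero: "compact_operator M V (\<lambda>f x. 0)"
proof (rule compact_operator_rank_one[where h = "\<lambda>x. 0" and l = "\<lambda>f. 0" and C = 0])
  have "wnorm M V (\<lambda>x. 0) = 0"
    using wnorm_le[of "\<lambda>x. 0" 0] wnorm_nonneg[OF wspace_zero] by simp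
  then show "bounded_operator M V (\<lambda>f x. 0)"
    by (intro bounded_operatorI[where C = 0]) (auto simp: wspace_zero)
qed (auto simp: wspace_zero)

section \<open>The essential spectral radius\<close>

text \<open>
  This is the norm of \<open>A\<close> in the Calkin algebra, and the quantity whose \<open>n\<close>-th root defines the
  essential spectral radius when \<open>A\<close> is an \<open>n\<close>-th power.
\<close>

definition compact_distance :: "'a operator \<Rightarrow> real" where
  "compact_distance A =
     (INF K\<in>Collect (compact_operator M V). operator_norm M V (\<lambda>f x. A f x - K f x))"

lemma minus_compact_norm_nonneg:
  assumes "bounded_operator M V A" "compact_operator M V K"
  shows "0 \<le> operator_norm M V (\<lambda>f x. A f x - K f x)"
  by (intro operator_norm_nonneg bounded_operator_minus assms compact_operator_bounded[OF assms(2)])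

lemma compact_distance_nonneg:
  assumes "bounded_operator M V A"
  shows "0 \<le> compact_distance A"
  unfolding compact_distance_def using minus_compact_norm_nonneg[OF assms] compact_operator_zero
  by (intro cINF_greatest) auto

lemma compact_distance_le:
  assumes "bounded_operator M V A" "compact_operator M V K"
  shows "compact_distance A \<le> operator_norm M V (\<lambda>f x. A f x - K f x)"
  unfolding compact_distance_def using minus_compact_norm_nonneg[OF assms(1)] assms
  by (intro cINF_lower bdd_belowI2[where m = 0]) auto

text \<open>
  \<open>A B\<close> and \<open>(A - K) (B - K')\<close> differ by a compact operator, since the compact operators form an
  ideal; then take the infimum over \<open>K\<close> and \<open>K'\<close>.
\<close>

lemma compact_distance_comp_le:
  assumes A: "bounded_operator M V A" and B: "bounded_operator M V B"
  shows "compact_distance (\<lambda>f. A (B f)) \<le> compact_distance A * compact_distance B"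
proof -
  have AB: "compact_distance (\<lambda>f. A (B f))
      \<le> operator_norm M V (\<lambda>f x. A f x - K f x) * operator_norm M V (\<lambda>f x. B f x - K' f x)"
    if K: "compact_operator M V K" and K': "compact_operator M V K'" for K K'
  proof -
    note bK = compact_operator_bounded[OF K] and bK' = compact_operator_bounded[OF K']
    let ?D = "\<lambda>f x. A f x - K f x" and ?D' = "\<lambda>f x. B f x - K' f x"
    have D: "bounded_operator M V ?D" by (rule bounded_operator_minus[OF A bK])
    have D': "bounded_operator M V ?D'" by (rule bounded_operator_minus[OF B bK'])
    \<comment> \<open>\<open>(A - K) (B - K') = A B - (K B + (A - K) K')\<close>, and the bracket is compact; it is written
        as the difference \<open>K B - (K - A) K'\<close> of compact operators.\<close>
    define K'' where "K'' = (\<lambda>f x. K (B f) x - (\<lambda>x. K (K' f) x - A (K' f) x) x)"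
    have "compact_operator M V K''"
      unfolding K''_def
      by (intro compact_operator_minus compact_operator_comp_right[OF K B]
          compact_operator_comp_left[OF bounded_operator_minus[OF bK A] K'])
    then have "compact_distance (\<lambda>f. A (B f)) \<le> operator_norm M V (\<lambda>f x. A (B f) x - K'' f x)"
      by (rule compact_distance_le[OF bounded_operator_comp[OF A B]])
    also have "\<dots> = operator_norm M V (\<lambda>f. ?D (?D' f))"
    proof (rule operator_norm_cong)
      fix f assume f: "f \<in> wspace M V"
      note wB = bounded_operator_wspace[OF B f] and wK' = bounded_operator_wspace[OF bK' f]
      show "(\<lambda>x. A (B f) x - K'' f x) = ?D (?D' f)"
        by (simp add: K''_def bounded_operator_diff[OF A wB wK'] bounded_operator_diff[OF bK wB wK'] algebra_simps)
    qed
    also have "\<dots> \<le> operator_norm M V ?D * operator_norm M V ?D'"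
      by (rule operator_norm_comp_le[OF D D'])
    finally show ?thesis .
  qed
  let ?ran = "\<lambda>A. (\<lambda>K. operator_norm M V (\<lambda>f x. A f x - K f x)) ` Collect (compact_operator M V)"
  have ne: "?ran A \<noteq> {}" for A using compact_operator_zero by blast
  have "compact_distance (\<lambda>f. A (B f)) \<le> compact_distance A * b" if "b \<in> ?ran B" for b
    unfolding compact_distance_def[of A]
    using that AB minus_compact_norm_nonneg[OF B] by (intro le_cInf_mult ne) auto
  then have "compact_distance (\<lambda>f. A (B f)) \<le> Inf (?ran B) * compact_distance A"
    by (intro le_cInf_mult ne compact_distance_nonneg A) (auto simp: mult.commute)
  then show ?thesis by (simp add: compact_distance_def[of B] mult.commute)
qed

lemma ess_spectral_radius_le:
  assumes T: "bounded_operator M V T" and C: "0 < C" and \<beta>: "0 \<le> \<beta>"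
    and bound: "\<And>n. \<exists>K. compact_operator M V K \<and>
      operator_norm M V (\<lambda>f x. (T ^^ n) f x - K f x) \<le> C * \<beta> ^ n"
  shows "ess_spectral_radius M V T \<le> \<beta>"
proof -
  define e where "e n = compact_distance (T ^^ n)" for n
  note Tn = bounded_operator_power[OF T]
  have e0: "0 \<le> e n" for n unfolding e_def by (rule compact_distance_nonneg[OF Tn])
  have "e (m + n) \<le> e m * e n" for m n
    using compact_distance_comp_le[OF Tn Tn, of m n] by (simp add: e_def funpow_add comp_def)
  then have conv: "convergent (\<lambda>n. root n (e n))"
    using e0 by (intro submultiplicative_root_convergent)
  have e_le: "e n \<le> C * \<beta> ^ n" for n
  proof -
    obtain K where K: "compact_operator M V K"
      "operator_norm M V (\<lambda>f x. (T ^^ n) f x - K f x) \<le> C * \<beta> ^ n"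
      using bound by blast
    show ?thesis unfolding e_def by (rule order_trans[OF compact_distance_le[OF Tn K(1)] K(2)])
  qed
  have "(\<lambda>n. root n (e n)) \<longlonglongrightarrow> ess_spectral_radius M V T"
    using conv unfolding ess_spectral_radius_def convergent_LIMSEQ_iff e_def compact_distance_def .
  moreover have "(\<lambda>n. root n C * \<beta>) \<longlonglongrightarrow> 1 * \<beta>"
    by (intro tendsto_intros LIMSEQ_root_const C)
  moreover have "root n (e n) \<le> root n C * \<beta>" if "n \<ge> 1" for n
  proof -
    have "root n (e n) \<le> root n (C * \<beta> ^ n)" using that e_le by simp
    also have "\<dots> = root n C * \<beta>" using that \<beta> by (simp add: real_root_mult real_root_power_cancel)
    finally show ?thesis .
  qed
  ultimately have "ess_spectral_radius M V T \<le> 1 * \<beta>"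
    by (intro LIMSEQ_le[of "\<lambda>n. root n (e n)" _ "\<lambda>n. root n C * \<beta>"]) blast+
  then show ?thesis by simp
qed

section \<open>The spectrum of a power-bounded operator\<close>

lemma power_boundedI:
  assumes T: "bounded_operator M V T"
    and bound: "\<And>n f. f \<in> wspace M V \<Longrightarrow> wnorm M V ((T ^^ n) f) \<le> C * wnorm M V f"
    and C: "0 \<le> C"
  shows "power_bounded M V T"
  unfolding power_bounded_def
proof
  have "operator_norm M V (T ^^ n) \<le> C" for n
  proof (rule operator_norm_le)
    fix f assume f: "f \<in> wspace M V" "wnorm M V f \<le> 1"
    show "wnorm M V ((T ^^ n) f) \<le> C"
      using bound[OF f(1), of n] mult_left_mono[OF f(2) C] by simp
  qed
  then show "bdd_above (range (\<lambda>n. operator_norm M V (T ^^ n)))"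
    by (intro bdd_aboveI2)
qed (rule T)

lemma power_boundedE:
  assumes "power_bounded M V T"
  obtains C where "\<And>n f. f \<in> wspace M V \<Longrightarrow> wnorm M V ((T ^^ n) f) \<le> C * wnorm M V f"
proof -
  have T: "bounded_operator M V T" using assms by (simp add: power_bounded_def)
  obtain C where C: "\<And>n. operator_norm M V (T ^^ n) \<le> C"
    using assms by (auto simp: power_bounded_def bdd_above_def)
  show ?thesis
  proof (rule that)
    fix n f assume f: "f \<in> wspace M V"
    show "wnorm M V ((T ^^ n) f) \<le> C * wnorm M V f"
      using wnorm_le_operator_norm[OF bounded_operator_power[OF T] f]
        mult_right_mono[OF C wnorm_nonneg[OF f]] by (rule order_trans)
  qed
qed

text \<open>
  The resolvent at \<open>z\<close> with \<open>norm z > 1\<close> is the Neumann series \<open>R = (\<Sum>n. T ^^ n / z ^ Suc n)\<close>,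
  which is taken pointwise so that completeness of the space is not involved. Splitting off the
  first term gives \<open>R (T f) = z * R f - f\<close>, which is one of the two identities. For the other it
  remains to see that \<open>D = T R - R T\<close> vanishes: the same splitting gives \<open>D f = D (T f) / z\<close>, hence
  \<open>D f = D (T ^^ n f) / z ^ n\<close>, and this tends to \<open>0\<close>.
\<close>

lemma power_bounded_spectrum:
  assumes pb: "power_bounded M V T" and z: "z \<in> op_spectrum M V T"
  shows "norm z \<le> 1"
proof (rule ccontr)
  assume "\<not> norm z \<le> 1"
  then have z1: "norm z > 1" by simp
  then have z0: "z \<noteq> 0" by auto
  have T: "bounded_operator M V T" using pb by (simp add: power_bounded_def)
  note Tn = bounded_operator_power[OF T]
  obtain C where C: "\<And>n f. f \<in> wspace M V \<Longrightarrow> wnorm M V ((T ^^ n) f) \<le> C * wnorm M V f"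
    using power_boundedE[OF pb] by blast
  define R where "R f x = (\<Sum>n. (T ^^ n) f x / z ^ Suc n)" for f x
  let ?q = "1 / norm z"
  have q: "0 \<le> ?q" "?q < 1" using z1 by (auto simp: divide_less_eq)
  have Tf: "T f \<in> wspace M V" if "f \<in> wspace M V" for f by (rule bounded_operator_wspace[OF T that])
  have term_le: "norm ((T ^^ n) f x / z ^ Suc n) \<le> ?q ^ Suc n * (C * wnorm M V f * V x)"
    if f: "f \<in> wspace M V" and x: "x \<in> space M" for f x n
  proof -
    have "norm ((T ^^ n) f x) \<le> wnorm M V ((T ^^ n) f) * V x"
      by (rule norm_le_wnorm[OF bounded_operator_wspace[OF Tn f] x])
    also have "\<dots> \<le> C * wnorm M V f * V x"
      using C[OF f] V_pos[OF x] by (intro mult_right_mono) auto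
    finally have "norm ((T ^^ n) f x) \<le> C * wnorm M V f * V x" .
    then have "norm ((T ^^ n) f x) * ?q ^ Suc n \<le> C * wnorm M V f * V x * ?q ^ Suc n"
      by (rule mult_right_mono) simp
    then show ?thesis by (simp add: norm_divide norm_mult norm_power power_divide mult.commute)
  qed
  have geom: "(\<lambda>n. ?q ^ Suc n * c) sums (?q / (1 - ?q) * c)" for c
    using sums_mult[OF sums_mult2[OF geometric_sums[of ?q]], of ?q c] q by (simp add: mult.assoc)
  have outside: "(T ^^ n) f x = 0" if "f \<in> wspace M V" "x \<notin> space M" for f n x
    by (rule wspace_outside[OF bounded_operator_wspace[OF Tn that(1)] that(2)])
  have summ: "summable (\<lambda>n. (T ^^ n) f x / z ^ Suc n)" if f: "f \<in> wspace M V" for f x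
  proof (cases "x \<in> space M")
    case True
    show ?thesis
      by (rule summable_comparison_test'[OF sums_summable[OF geom] term_le[OF f True]])
  qed (simp add: outside[OF f])
  have R_le: "norm (R f x) \<le> (?q / (1 - ?q) * C * wnorm M V f) * V x"
    if f: "f \<in> wspace M V" and x: "x \<in> space M" for f x
  proof -
    have "norm (R f x) \<le> (\<Sum>n. ?q ^ Suc n * (C * wnorm M V f * V x))"
      unfolding R_def by (rule norm_suminf_le[OF term_le[OF f x] sums_summable[OF geom]])
    also have "\<dots> = ?q / (1 - ?q) * (C * wnorm M V f * V x)" by (rule sums_unique[OF geom, symmetric])
    finally show ?thesis by (simp add: mult.assoc)
  qed
  have R: "bounded_operator M V R"
  proof (rule bounded_operatorI[where C = "?q / (1 - ?q) * C"])
    fix f assume f: "f \<in> wspace M V"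
    show "wnorm M V (R f) \<le> ?q / (1 - ?q) * C * wnorm M V f"
      by (rule wnorm_le[OF R_le[OF f]])
    have "(\<lambda>x. (T ^^ n) f x) \<in> borel_measurable M" for n
      using bounded_operator_wspace[OF Tn f] by (rule wspace_measurable)
    then have "(\<lambda>x. R f x) \<in> borel_measurable M"
      unfolding R_def by measurable
    then show "R f \<in> wspace M V"
      by (intro wspaceI[OF _ _ R_le[OF f]]) (auto simp: R_def outside[OF f])
  next
    fix f g x assume f: "f \<in> wspace M V" and g: "g \<in> wspace M V"
    show "R (\<lambda>x. f x + g x) x = R f x + R g x"
      unfolding R_def suminf_add[OF summ[OF f] summ[OF g]]
      by (simp add: bounded_operator_add[OF Tn f g] add_divide_distrib)
  next
    fix c f x assume f: "f \<in> wspace M V"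
    show "R (\<lambda>x. c * f x) x = c * R f x"
      unfolding R_def suminf_mult[OF summ[OF f], symmetric]
      by (simp add: bounded_operator_scale[OF Tn f])
  qed
  have RT: "R (T f) = (\<lambda>x. z * R f x - f x)" if f: "f \<in> wspace M V" for f
  proof
    fix x
    have "(\<Sum>n. (T ^^ Suc n) f x / z ^ Suc (Suc n)) = R f x - f x / z"
      using suminf_split_head[OF summ[OF f, of x]] by (simp add: R_def)
    moreover have "(\<Sum>n. (T ^^ Suc n) f x / z ^ Suc (Suc n)) = R (T f) x / z"
      unfolding R_def suminf_divide[OF summ[OF Tf[OF f]], symmetric]
      by (simp add: funpow_swap1 mult.commute)
    ultimately show "R (T f) x = z * R f x - f x" using z0 by (simp add: field_simps)
  qed
  have wR: "R f \<in> wspace M V" if "f \<in> wspace M V" for f by (rule bounded_operator_wspace[OF R that])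
  define D where "D f x = T (R f) x - R (T f) x" for f x
  have D: "bounded_operator M V D"
    unfolding D_def
    by (rule bounded_operator_minus[OF bounded_operator_comp[OF T R] bounded_operator_comp[OF R T]])
  have DT: "D (T f) = (\<lambda>x. z * D f x)" if f: "f \<in> wspace M V" for f
    by (rule ext) (simp add: D_def RT f Tf bounded_operator_diff[OF T wspace_scale[OF wR[OF f]] f]
        bounded_operator_scale[OF T wR[OF f]] algebra_simps)
  have DTn: "D ((T ^^ n) f) x = z ^ n * D f x" if f: "f \<in> wspace M V" for f n x
    by (induction n) (simp_all add: DT bounded_operator_wspace[OF Tn f])
  have D0: "D f x = 0" if f: "f \<in> wspace M V" for f x
  proof (cases "x \<in> space M")
    case True
    obtain c where c: "0 \<le> c" "\<And>f. f \<in> wspace M V \<Longrightarrow> wnorm M V (D f) \<le> c * wnorm M V f"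
      using bounded_operatorE[OF D] by blast
    define B where "B = c * (C * wnorm M V f) * V x"
    have le: "norm (D f x) \<le> ?q ^ n * B" for n
    proof -
      note w = bounded_operator_wspace[OF Tn f, of n]
      have "norm (D ((T ^^ n) f) x) \<le> wnorm M V (D ((T ^^ n) f)) * V x"
        by (rule norm_le_wnorm[OF bounded_operator_wspace[OF D w] True])
      also have "\<dots> \<le> B" unfolding B_def
        using order_trans[OF c(2)[OF w] mult_left_mono[OF C[OF f] c(1)]] V_pos[OF True]
        by (intro mult_right_mono) auto
      finally have "norm z ^ n * norm (D f x) \<le> B" by (simp add: DTn[OF f] norm_mult norm_power)
      then show ?thesis using z0 by (simp add: power_divide pos_le_divide_eq mult.commute)
    qed
    have "(\<lambda>n. ?q ^ n * B) \<longlonglongrightarrow> 0 * B"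
      by (intro tendsto_mult tendsto_const LIMSEQ_power_zero) (use q in auto)
    then have "norm (D f x) \<le> 0 * B" by (rule LIMSEQ_le_const) (use le in blast)
    then show ?thesis by simp
  qed (rule wspace_outside[OF bounded_operator_wspace[OF D f]])
  have "z \<notin> op_spectrum M V T"
    unfolding op_spectrum_def
  proof (clarsimp, intro exI[of _ R] conjI ballI R)
    fix f assume f: "f \<in> wspace M V"
    show "R (\<lambda>x. z * f x - T f x) = f"
      using RT[OF f] by (simp add: bounded_operator_diff[OF R wspace_scale[OF f] Tf[OF f]]
          bounded_operator_scale[OF R f])
    show "(\<lambda>x. z * R f x - T (R f) x) = f"
      using D0[OF f] RT[OF f] by (simp add: D_def)
  qed
  then show False using z by simp
qed

lemma eigenvalue_in_spectrum:
  assumes f: "f \<in> wspace M V" "f \<noteq> (\<lambda>x. 0)" and eq: "T f = (\<lambda>x. z * f x)"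
  shows "z \<in> op_spectrum M V T"
proof -
  have "R (\<lambda>x. z * f x - T f x) \<noteq> f" if "bounded_operator M V R" for R
    using bounded_operator_zero[OF that] f(2) by (simp add: eq)
  then show ?thesis unfolding op_spectrum_def using f(1) by blast
qed

lemma power_bounded_spectral_radius_eq_1:
  assumes pb: "power_bounded M V T" and f: "f \<in> wspace M V" "f \<noteq> (\<lambda>x. 0)" "T f = f"
  shows "op_spectral_radius M V T = 1"
proof -
  have one: "1 \<in> op_spectrum M V T" using f by (intro eigenvalue_in_spectrum) auto
  show ?thesis
    unfolding op_spectral_radius_def
  proof (rule antisym)
    show "(SUP z\<in>op_spectrum M V T. norm z) \<le> 1"
      using one power_bounded_spectrum[OF pb] by (intro cSUP_least) auto
    have "norm (1 :: complex) \<le> (SUP z\<in>op_spectrum M V T. norm z)"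
      using power_bounded_spectrum[OF pb] by (intro cSUP_upper one bdd_aboveI2[where M = 1])
    then show "1 \<le> (SUP z\<in>op_spectrum M V T. norm z)" by simp
  qed
qed

end

section \<open>Subtracting a dominated measure\<close>

lemma le_measure_integrable:
  fixes f :: "'a \<Rightarrow> 'b::{banach, second_countable_topology}"
  assumes sets: "sets \<nu> = sets \<mu>" and le: "\<nu> \<le> \<mu>" and f: "integrable \<mu> f"
  shows "integrable \<nu> f"
proof (rule integrableI_bounded)
  show "f \<in> borel_measurable \<nu>"
    using borel_measurable_integrable[OF f] by (simp cong: measurable_cong_sets add: sets)
  have "(\<integral>\<^sup>+x. ennreal (norm (f x)) \<partial>\<nu>) \<le> (\<integral>\<^sup>+x. ennreal (norm (f x)) \<partial>\<mu>)"
    by (rule nn_integral_mono_measure[OF sets le])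
  also have "\<dots> < \<infinity>" using f by (simp add: integrable_iff_bounded)
  finally show "(\<integral>\<^sup>+x. ennreal (norm (f x)) \<partial>\<nu>) < \<infinity>" .
qed

lemma le_measure_integral_mono:
  fixes g :: "'a \<Rightarrow> real"
  assumes sets: "sets \<nu> = sets \<mu>" and le: "\<nu> \<le> \<mu>" and g: "integrable \<mu> g"
    and nonneg: "\<And>x. x \<in> space \<mu> \<Longrightarrow> 0 \<le> g x"
  shows "(\<integral>x. g x \<partial>\<nu>) \<le> (\<integral>x. g x \<partial>\<mu>)"
proof -
  have "ennreal (\<integral>x. g x \<partial>\<nu>) = (\<integral>\<^sup>+x. ennreal (g x) \<partial>\<nu>)"
    by (rule nn_integral_eq_integral[symmetric])
      (auto intro!: AE_I2 le_measure_integrable[OF sets le g] nonneg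
        simp: sets_eq_imp_space_eq[OF sets])
  also have "\<dots> \<le> (\<integral>\<^sup>+x. ennreal (g x) \<partial>\<mu>)"
    by (rule nn_integral_mono_measure[OF sets le])
  also have "\<dots> = ennreal (\<integral>x. g x \<partial>\<mu>)"
    by (rule nn_integral_eq_integral[OF g]) (auto intro: nonneg)
  finally show ?thesis
    using nonneg by (simp add: ennreal_le_iff Bochner_Integration.integral_nonneg)
qed

text \<open>
  This is the triangle inequality for the positive measure \<open>\<mu> - \<nu>\<close>. Multiplying \<open>f\<close> by a
  unimodular constant makes the left-hand side the integral of a real function \<open>Re (u * f)\<close>, and
  \<open>g - Re (u * f)\<close> is nonnegative.
\<close>

lemma norm_integral_diff_le:
  fixes f :: "'a \<Rightarrow> complex"
  assumes sets: "sets \<nu> = sets \<mu>" and le: "\<nu> \<le> \<mu>"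
    and f: "integrable \<mu> f" and g: "integrable \<mu> g"
    and fg: "\<And>x. x \<in> space \<mu> \<Longrightarrow> norm (f x) \<le> g x"
  shows "norm ((\<integral>x. f x \<partial>\<mu>) - (\<integral>x. f x \<partial>\<nu>)) \<le> (\<integral>x. g x \<partial>\<mu>) - (\<integral>x. g x \<partial>\<nu>)"
proof -
  define d where "d = (\<integral>x. f x \<partial>\<mu>) - (\<integral>x. f x \<partial>\<nu>)"
  define u where "u = cnj (sgn d)"
  have u1: "norm u \<le> 1" by (simp add: u_def norm_sgn)
  have ud: "Re (u * d) = norm d"
  proof -
    have "u * d = complex_of_real (norm d)"
      by (cases "d = 0") (simp_all add: u_def sgn_eq complex_norm_square[symmetric] mult.commute
          power2_eq_square)
    then show ?thesis by simp
  qed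
  have f': "integrable \<nu> f" and g': "integrable \<nu> g"
    by (intro le_measure_integrable[OF sets le] f g)+
  have h: "integrable \<mu> (\<lambda>x. g x - Re (u * f x))"
    by (intro Bochner_Integration.integrable_diff integrable_Re integrable_mult_right g f)
  have "(\<integral>x. g x - Re (u * f x) \<partial>\<nu>) \<le> (\<integral>x. g x - Re (u * f x) \<partial>\<mu>)"
  proof (rule le_measure_integral_mono[OF sets le h])
    fix x assume x: "x \<in> space \<mu>"
    have "Re (u * f x) \<le> norm u * norm (f x)"
      using complex_Re_le_cmod[of "u * f x"] by (simp add: norm_mult)
    also have "\<dots> \<le> norm (f x)" using u1 by (simp add: mult_left_le_one_le)
    finally show "0 \<le> g x - Re (u * f x)" using fg[OF x] by simp
  qed
  moreover have "(\<integral>x. g x - Re (u * f x) \<partial>\<nu>) = (\<integral>x. g x \<partial>\<nu>) - Re (u * (\<integral>x. f x \<partial>\<nu>))"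
    by (simp only: Bochner_Integration.integral_diff integrable_Re integrable_mult_right f' g'
        integral_Re integral_mult_right_zero)
  moreover have "(\<integral>x. g x - Re (u * f x) \<partial>\<mu>) = (\<integral>x. g x \<partial>\<mu>) - Re (u * (\<integral>x. f x \<partial>\<mu>))"
    by (simp only: Bochner_Integration.integral_diff integrable_Re integrable_mult_right f g
        integral_Re integral_mult_right_zero)
  moreover have "Re (u * d) = Re (u * (\<integral>x. f x \<partial>\<mu>)) - Re (u * (\<integral>x. f x \<partial>\<nu>))"
    by (simp add: d_def algebra_simps)
  ultimately have "norm d \<le> (\<integral>x. g x \<partial>\<mu>) - (\<integral>x. g x \<partial>\<nu>)"
    using ud by linarith
  then show ?thesis by (simp add: d_def)
qed

section \<open>Drift and minorization\<close>

locale drift_minorization = weighted_space M V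
  for M :: "'a measure" and V :: "'a \<Rightarrow> real" +
  fixes P :: "'a \<Rightarrow> 'a measure" and S :: "'a set" and \<nu> :: "'a measure" and \<delta> L :: real
  assumes kernel: "P \<in> M \<rightarrow>\<^sub>M prob_algebra M"
    and S_sets [measurable]: "S \<in> sets M" and S_nonempty: "S \<noteq> {}"
    and sets_\<nu>: "sets \<nu> = sets M" and \<nu>_pos: "0 < emeasure \<nu> (space M)"
    and \<delta>: "0 < \<delta>" "\<delta> < 1" and L: "0 < L"
    and drift: "\<And>x. x \<in> space M \<Longrightarrow>
      (\<integral>\<^sup>+y. ennreal (V y) \<partial>P x) \<le> ennreal (\<delta> * V x + L * indicator S x)"
    and minorization: "\<And>x A. x \<in> space M \<Longrightarrow> A \<in> sets M \<Longrightarrow>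
      emeasure \<nu> A * indicator S x \<le> emeasure (P x) A"
begin

lemma sets_P: "x \<in> space M \<Longrightarrow> sets (P x) = sets M"
  and prob_space_P: "x \<in> space M \<Longrightarrow> prob_space (P x)"
  using measurable_space[OF kernel] by (auto simp: space_prob_algebra)

lemma space_P: "x \<in> space M \<Longrightarrow> space (P x) = space M"
  by (rule sets_eq_imp_space_eq[OF sets_P])

lemma space_\<nu>: "space \<nu> = space M"
  by (rule sets_eq_imp_space_eq[OF sets_\<nu>])

lemma S_subset: "x \<in> S \<Longrightarrow> x \<in> space M"
  using sets.sets_into_space[OF S_sets] by blast

lemma measurable_P: "x \<in> space M \<Longrightarrow> f \<in> borel_measurable M \<Longrightarrow> f \<in> borel_measurable (P x)"
  by (simp cong: measurable_cong_sets add: sets_P)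

lemma V_integrable_P:
  assumes x: "x \<in> space M"
  shows "integrable (P x) V"
proof (rule integrableI_nonneg)
  show "V \<in> borel_measurable (P x)" by (rule measurable_P[OF x V_meas])
  show "AE y in P x. 0 \<le> V y"
    using V_pos by (intro AE_I2) (force simp: space_P[OF x])
  show "(\<integral>\<^sup>+y. ennreal (V y) \<partial>P x) < \<infinity>"
    by (rule le_less_trans[OF drift[OF x]]) simp
qed

lemma integral_V_le:
  assumes x: "x \<in> space M"
  shows "(\<integral>y. V y \<partial>P x) \<le> \<delta> * V x + L * indicator S x"
proof -
  have "ennreal (\<integral>y. V y \<partial>P x) = (\<integral>\<^sup>+y. ennreal (V y) \<partial>P x)"
    using V_pos by (intro nn_integral_eq_integral[symmetric] V_integrable_P[OF x] AE_I2)
      (force simp: space_P[OF x])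
  also have "\<dots> \<le> ennreal (\<delta> * V x + L * indicator S x)" by (rule drift[OF x])
  finally show ?thesis
    using \<delta> L V_pos[OF x] by (subst (asm) ennreal_le_iff) (auto intro!: add_nonneg_nonneg)
qed

lemma wspace_integrable_P:
  assumes "f \<in> wspace M V" and x: "x \<in> space M"
  shows "integrable (P x) f"
proof (rule Bochner_Integration.integrable_bound)
  show "integrable (P x) (\<lambda>y. wnorm M V f * V y)"
    by (intro integrable_mult_right V_integrable_P[OF x])
  show "f \<in> borel_measurable (P x)" by (rule measurable_P[OF x wspace_measurable[OF assms(1)]])
  show "AE y in P x. norm (f y) \<le> norm (wnorm M V f * V y)"
    using norm_le_wnorm[OF assms(1)]
    by (intro AE_I2) (force simp: space_P[OF x] intro: order_trans[OF _ abs_ge_self])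
qed

lemma integrable_const_P: "x \<in> space M \<Longrightarrow> integrable (P x) (\<lambda>y. c :: real)"
  using prob_space_P by (simp add: prob_space.finite_measure finite_measure.integrable_const)

lemma integral_affine_P:
  assumes x: "x \<in> space M"
  shows "(\<integral>y. a * V y + b \<partial>P x) = a * (\<integral>y. V y \<partial>P x) + b"
  using V_integrable_P[OF x] integrable_const_P[OF x] prob_space.prob_space[OF prob_space_P[OF x]]
  by simp

lemma integrable_affine_P: "x \<in> space M \<Longrightarrow> integrable (P x) (\<lambda>y. a * V y + b)"
  using V_integrable_P integrable_const_P by auto

lemma \<nu>_le_P:
  assumes "x \<in> S"
  shows "\<nu> \<le> P x"
  using minorization[OF S_subset[OF assms]] assms
  by (subst le_measure) (auto simp: sets_\<nu> sets_P[OF S_subset[OF assms]])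

lemma integrable_\<nu>:
  fixes f :: "'a \<Rightarrow> 'b::{banach, second_countable_topology}"
  assumes "\<And>x. x \<in> space M \<Longrightarrow> integrable (P x) f"
  shows "integrable \<nu> f"
proof -
  obtain x where x: "x \<in> S" using S_nonempty by blast
  show ?thesis
    by (rule le_measure_integrable[OF _ \<nu>_le_P[OF x] assms[OF S_subset[OF x]]])
      (simp add: sets_\<nu> sets_P[OF S_subset[OF x]])
qed

lemma finite_\<nu>: "emeasure \<nu> (space M) < \<infinity>"
proof -
  have "integrable \<nu> (\<lambda>x. 1 :: real)" by (intro integrable_\<nu> integrable_const_P)
  then show ?thesis by (simp add: integrable_iff_bounded space_\<nu>)
qed

lemma measure_\<nu>_pos: "0 < measure \<nu> (space M)"
  using \<nu>_pos finite_\<nu> by (simp add: measure_def enn2real_positive_iff)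

lemma integral_affine_\<nu>: "(\<integral>y. a * V y + b \<partial>\<nu>) = a * (\<integral>y. V y \<partial>\<nu>) + b * measure \<nu> (space M)"
  using integrable_\<nu>[OF V_integrable_P] integrable_\<nu>[OF integrable_const_P, of b]
  by (simp add: space_\<nu>)

abbreviation PP :: "'a operator" where "PP \<equiv> kernel_operator M P"

text \<open>
  Bounds of the form \<open>a V + b\<close> are what the drift condition propagates, the constant being
  preserved by \<open>P\<close>. Working with pointwise bounds on \<open>f\<close> makes iteration an induction over the
  operator, without iterated kernels.
\<close>

lemma kernel_norm_le:
  assumes f: "f \<in> wspace M V" and x: "x \<in> space M" and a: "0 \<le> a"
    and le: "\<And>y. y \<in> space M \<Longrightarrow> norm (f y) \<le> a * V y + b"
  shows "norm (PP f x) \<le> a * (\<delta> * V x + L * indicator S x) + b"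
proof -
  have "norm (PP f x) \<le> (\<integral>y. norm (f y) \<partial>P x)"
    using x by (simp add: kernel_operator_def)
  also have "\<dots> \<le> (\<integral>y. a * V y + b \<partial>P x)"
    using le by (intro integral_mono integrable_norm wspace_integrable_P[OF f x]
        integrable_affine_P[OF x]) (simp add: space_P[OF x])
  also have "\<dots> \<le> a * (\<delta> * V x + L * indicator S x) + b"
    using mult_left_mono[OF integral_V_le[OF x] a] by (simp add: integral_affine_P[OF x])
  finally show ?thesis .
qed

lemma kernel_wnorm_le:
  assumes f: "f \<in> wspace M V" and x: "x \<in> space M"
  shows "norm (PP f x) \<le> ((\<delta> + L) * wnorm M V f) * V x"
proof -
  have "L * indicator S x \<le> L * V x"
    using V_ge_1[OF x] L by (intro mult_left_mono) (auto simp: indicator_def)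
  then have "wnorm M V f * (\<delta> * V x + L * indicator S x) \<le> wnorm M V f * ((\<delta> + L) * V x)"
    by (intro mult_left_mono wnorm_nonneg[OF f]) (simp add: algebra_simps)
  then show ?thesis
    using kernel_norm_le[OF f x wnorm_nonneg[OF f], of 0] norm_le_wnorm[OF f]
    by (simp add: mult_ac)
qed

lemma kernel_bounded: "bounded_operator M V PP"
proof (rule bounded_operatorI[where C = "\<delta> + L"])
  fix f assume f: "f \<in> wspace M V"
  have "(\<lambda>x. \<integral>y. f y \<partial>P x) \<in> borel_measurable M"
    by (rule measurable_compose[OF measurable_prob_algebraD[OF kernel]
          integral_measurable_subprob_algebra[OF wspace_measurable[OF f]]])
  then have "PP f \<in> borel_measurable M"
    by (rule measurable_cong[THEN iffD1, rotated]) (simp add: kernel_operator_def)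
  then show "PP f \<in> wspace M V"
    by (rule wspaceI[OF _ _ kernel_wnorm_le[OF f]]) (simp add: kernel_operator_def)
  show "wnorm M V (PP f) \<le> (\<delta> + L) * wnorm M V f"
    by (rule wnorm_le[OF kernel_wnorm_le[OF f]])
next
  fix f g x assume "f \<in> wspace M V" "g \<in> wspace M V"
  then show "PP (\<lambda>x. f x + g x) x = PP f x + PP g x"
    using wspace_integrable_P by (auto simp: kernel_operator_def)
qed (simp add: kernel_operator_def)

text \<open>
  Iterating \<open>P V \<le> \<delta> V + L\<close> gives \<open>P ^^ n V \<le> \<delta> ^ n V + (1 - \<delta> ^ n) c\<close> with \<open>c\<close> the fixed point
  of \<open>t \<mapsto> \<delta> t + L\<close>; being bounded in \<open>n\<close>, this is what power-boundedness needs.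
\<close>

lemma kernel_power_norm_le:
  assumes f: "f \<in> wspace M V" and x: "x \<in> space M"
  defines "c \<equiv> L / (1 - \<delta>)"
  shows "norm ((PP ^^ n) f x) \<le> wnorm M V f * \<delta> ^ n * V x + wnorm M V f * (1 - \<delta> ^ n) * c"
  using x
proof (induction n arbitrary: x)
  case 0
  then show ?case using norm_le_wnorm[OF f] by simp
next
  case (Suc n)
  let ?w = "wnorm M V f"
  have L_eq: "L = (1 - \<delta>) * c" using \<delta> by (simp add: c_def)
  have a: "0 \<le> ?w * \<delta> ^ n" using wnorm_nonneg[OF f] \<delta> by simp
  have "norm (PP ((PP ^^ n) f) x)
      \<le> ?w * \<delta> ^ n * (\<delta> * V x + L * indicator S x) + ?w * (1 - \<delta> ^ n) * c"
    by (rule kernel_norm_le[OF bounded_operator_wspace[OF bounded_operator_power[OF kernel_bounded] f]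
          Suc.prems a Suc.IH])
  also have "\<dots> \<le> ?w * \<delta> ^ n * (\<delta> * V x + L) + ?w * (1 - \<delta> ^ n) * c"
    using L by (intro add_right_mono mult_left_mono a add_left_mono) (simp add: indicator_def)
  also have "\<dots> = ?w * \<delta> ^ Suc n * V x + ?w * (1 - \<delta> ^ Suc n) * c"
    unfolding L_eq by (simp add: algebra_simps)
  finally show ?case by simp
qed

lemma kernel_power_bounded: "power_bounded M V PP"
proof (rule power_boundedI[OF kernel_bounded, where C = "1 + L / (1 - \<delta>)"])
  let ?c = "L / (1 - \<delta>)"
  show "0 \<le> 1 + ?c" using \<delta> L by simp
  fix n f assume f: "f \<in> wspace M V"
  show "wnorm M V ((PP ^^ n) f) \<le> (1 + ?c) * wnorm M V f"
  proof (rule wnorm_le)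
    fix x assume x: "x \<in> space M"
    let ?w = "wnorm M V f"
    have w: "0 \<le> ?w" by (rule wnorm_nonneg[OF f])
    have \<delta>n: "0 \<le> \<delta> ^ n" "\<delta> ^ n \<le> 1" using \<delta> by (auto intro: power_le_one)
    have c: "0 \<le> ?c" using \<delta> L by simp
    have "?w * \<delta> ^ n * V x \<le> ?w * 1 * V x"
      using \<delta>n w V_pos[OF x] by (intro mult_right_mono mult_left_mono) auto
    moreover have "?w * (1 - \<delta> ^ n) * ?c \<le> ?w * V x * ?c"
      using \<delta>n w c V_ge_1[OF x] by (intro mult_right_mono mult_left_mono) auto
    ultimately show "norm ((PP ^^ n) f x) \<le> (1 + ?c) * ?w * V x"
      using kernel_power_norm_le[OF f x, of n] by (simp add: algebra_simps)
  qed
qed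

lemma kernel_fixes_one: "PP (indicator (space M)) = indicator (space M)"
proof
  fix x
  show "PP (indicator (space M)) x = indicator (space M) x"
  proof (cases "x \<in> space M")
    case True
    then have "(\<integral>y. indicator (space M) y \<partial>P x) = (\<integral>y. 1 \<partial>P x :: complex)"
      by (intro Bochner_Integration.integral_cong) (auto simp: space_P)
    then show ?thesis
      using True prob_space.prob_space[OF prob_space_P[OF True]] by (simp add: kernel_operator_def)
  qed (simp add: kernel_operator_def)
qed

lemma indicator_space_wspace: "(indicator (space M) :: 'a \<Rightarrow> complex) \<in> wspace M V"
  using V_ge_1 by (intro wspaceI[where a = 1]) auto

lemma kernel_spectral_radius: "op_spectral_radius M V PP = 1"
proof (rule power_bounded_spectral_radius_eq_1[OF kernel_power_bounded indicator_space_wspace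
      _ kernel_fixes_one])
  show "(indicator (space M) :: 'a \<Rightarrow> complex) \<noteq> (\<lambda>x. 0)"
    using space_nonempty by (auto simp: fun_eq_iff indicator_def)
qed

section \<open>The residual kernel\<close>

definition residual :: "'a operator" where
  "residual f = (\<lambda>x. PP f x - (\<integral>y. f y \<partial>\<nu>) * indicator S x)"

definition \<tau> :: real where "\<tau> = max 0 (L - (\<integral>x. V x \<partial>\<nu>))"

definition rate :: real where
  "rate = (\<delta> * measure \<nu> (space M) + \<tau>) / (measure \<nu> (space M) + \<tau>)"

text \<open>
  This is the constant added to the weight \<open>V\<close> to make the residual kernel a contraction.
\<close>

definition offset :: real where "offset = \<tau> / measure \<nu> (space M)"

lemma offset_nonneg: "0 \<le> offset"
  using measure_\<nu>_pos by (simp add: offset_def \<tau>_def)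

lemma rate_eq: "rate = (\<delta> + offset) / (1 + offset)"
  using measure_\<nu>_pos unfolding rate_def offset_def
  by (simp add: divide_simps)

lemma rate_nonneg: "0 \<le> rate"
  using \<delta> offset_nonneg by (simp add: rate_eq)

lemma rate_less_1: "rate < 1"
  using \<delta> offset_nonneg by (simp add: rate_eq divide_less_eq)

text \<open>
  On \<open>S\<close> the choice of \<open>offset\<close> turns the excess \<open>L - \<nu>(V)\<close> of the drift condition into at most
  the loss \<open>offset * \<nu>(1)\<close>; off \<open>S\<close> the residual kernel is \<open>P\<close> itself. In both cases the
  result is \<open>\<delta> V + offset\<close>, and comparing it with \<open>rate * (V + offset)\<close> amounts to
  \<open>0 \<le> offset * (V - 1) * (1 - \<delta>)\<close>.
\<close>

lemma residual_norm_le: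
  assumes f: "f \<in> wspace M V" and x: "x \<in> space M" and a: "0 \<le> a"
    and le: "\<And>y. y \<in> space M \<Longrightarrow> norm (f y) \<le> a * (V y + offset)"
  shows "norm (residual f x) \<le> a * rate * (V x + offset)"
proof -
  have "norm (residual f x) \<le> a * (\<delta> * V x + offset)"
  proof (cases "x \<in> S")
    case True
    have "norm (residual f x) = norm ((\<integral>y. f y \<partial>P x) - (\<integral>y. f y \<partial>\<nu>))"
      using True x by (simp add: residual_def kernel_operator_def)
    also have "\<dots> \<le> (\<integral>y. a * V y + a * offset \<partial>P x) - (\<integral>y. a * V y + a * offset \<partial>\<nu>)"
      using le by (intro norm_integral_diff_le \<nu>_le_P[OF True] wspace_integrable_P[OF f x]
          integrable_affine_P[OF x]) (simp_all add: sets_\<nu> sets_P[OF x] space_P[OF x] distrib_left)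
    also have "\<dots> = a * ((\<integral>y. V y \<partial>P x) - (\<integral>y. V y \<partial>\<nu>) + offset - offset * measure \<nu> (space M))"
      by (simp add: integral_affine_P[OF x] integral_affine_\<nu> algebra_simps)
    also have "\<dots> \<le> a * (\<delta> * V x + offset)"
    proof (rule mult_left_mono[OF _ a])
      have "L - (\<integral>y. V y \<partial>\<nu>) \<le> offset * measure \<nu> (space M)"
        using measure_\<nu>_pos by (simp add: offset_def \<tau>_def)
      then show "(\<integral>y. V y \<partial>P x) - (\<integral>y. V y \<partial>\<nu>) + offset - offset * measure \<nu> (space M)
          \<le> \<delta> * V x + offset"
        using integral_V_le[OF x] True by simp
    qed
    finally show ?thesis .
  next
    case False
    then show ?thesis
      using kernel_norm_le[OF f x a, of "a * offset"] le
      by (simp add: residual_def distrib_left)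
  qed
  also have "\<dots> \<le> a * (rate * (V x + offset))"
  proof (rule mult_left_mono[OF _ a])
    have "0 \<le> offset * ((V x - 1) * (1 - \<delta>))"
      using offset_nonneg V_ge_1[OF x] \<delta> by simp
    then have "(\<delta> * V x + offset) * (1 + offset) \<le> (\<delta> + offset) * (V x + offset)"
      by (simp add: algebra_simps)
    then show "\<delta> * V x + offset \<le> rate * (V x + offset)"
      using offset_nonneg by (simp add: rate_eq pos_le_divide_eq)
  qed
  finally show ?thesis by (simp add: mult.assoc)
qed

lemma integral_\<nu>_norm_le:
  assumes f: "f \<in> wspace M V"
  shows "norm (\<integral>y. f y \<partial>\<nu>) \<le> (\<integral>y. V y \<partial>\<nu>) * wnorm M V f"
proof -
  have "norm (\<integral>y. f y \<partial>\<nu>) \<le> (\<integral>y. norm (f y) \<partial>\<nu>)" by simp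
  also have "\<dots> \<le> (\<integral>y. wnorm M V f * V y \<partial>\<nu>)"
    using norm_le_wnorm[OF f]
    by (intro integral_mono integrable_norm integrable_mult_right integrable_\<nu>
        wspace_integrable_P[OF f] V_integrable_P) (auto simp: space_\<nu>)
  finally show ?thesis by (simp add: mult.commute)
qed

lemma indicator_S_wspace: "(indicator S :: 'a \<Rightarrow> complex) \<in> wspace M V"
proof (rule wspaceI[where a = 1])
  show "norm (indicator S x :: complex) \<le> 1 * V x" if "x \<in> space M" for x
    using V_ge_1[OF that] by (simp add: indicator_def)
qed (use S_subset in \<open>auto simp: indicator_def\<close>)

lemma minorant_compact:
  "compact_operator M V (\<lambda>f x. (\<integral>y. f y \<partial>\<nu>) * indicator S x)" (is "compact_operator M V ?T")
proof (rule compact_operator_rank_one[OF _ indicator_S_wspace _ integral_\<nu>_norm_le])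
  show "bounded_operator M V ?T"
  proof (rule bounded_operatorI[where C = "(\<integral>y. V y \<partial>\<nu>) * wnorm M V (indicator S)"])
    fix f assume f: "f \<in> wspace M V"
    show "?T f \<in> wspace M V" by (rule wspace_scale[OF indicator_S_wspace])
    show "wnorm M V (?T f) \<le> (\<integral>y. V y \<partial>\<nu>) * wnorm M V (indicator S) * wnorm M V f"
      using wnorm_scale_le[OF indicator_S_wspace, of "\<integral>y. f y \<partial>\<nu>"]
        mult_right_mono[OF integral_\<nu>_norm_le[OF f] wnorm_nonneg[OF indicator_S_wspace]]
      by (simp add: mult_ac)
  next
    fix f g x assume "f \<in> wspace M V" "g \<in> wspace M V"
    then show "?T (\<lambda>x. f x + g x) x = ?T f x + ?T g x"
      by (simp add: integrable_\<nu>[OF wspace_integrable_P] distrib_right)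
  qed simp
qed simp

lemma residual_bounded: "bounded_operator M V residual"
  using bounded_operator_minus[OF kernel_bounded compact_operator_bounded[OF minorant_compact]]
  by (simp add: residual_def[abs_def])

lemma residual_power_norm_le:
  assumes f: "f \<in> wspace M V" and x: "x \<in> space M"
  shows "norm ((residual ^^ n) f x) \<le> wnorm M V f * rate ^ n * (V x + offset)"
  using x
proof (induction n arbitrary: x)
  case 0
  have "norm (f x) \<le> wnorm M V f * V x" by (rule norm_le_wnorm[OF f 0])
  also have "\<dots> \<le> wnorm M V f * (V x + offset)"
    using offset_nonneg by (intro mult_left_mono wnorm_nonneg[OF f]) simp
  finally show ?case by simp
next
  case (Suc n)
  have "0 \<le> wnorm M V f * rate ^ n" using wnorm_nonneg[OF f] rate_nonneg by simp
  from residual_norm_le[OF bounded_operator_wspace[OF bounded_operator_power[OF residual_bounded] f]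
      Suc.prems this Suc.IH]
  show ?case by (simp add: mult_ac)
qed

lemma residual_power_operator_norm_le:
  "operator_norm M V (residual ^^ n) \<le> (1 + offset) * rate ^ n"
proof (intro operator_norm_le wnorm_le)
  fix f x assume f: "f \<in> wspace M V" "wnorm M V f \<le> 1" and x: "x \<in> space M"
  have "norm ((residual ^^ n) f x) \<le> wnorm M V f * (rate ^ n * (V x + offset))"
    using residual_power_norm_le[OF f(1) x] by (simp add: mult.assoc)
  also have "\<dots> \<le> 1 * (rate ^ n * (V x + offset))"
    using f(2) rate_nonneg offset_nonneg V_pos[OF x] by (intro mult_right_mono) auto
  also have "\<dots> \<le> rate ^ n * ((1 + offset) * V x)"
    using mult_left_mono[OF V_ge_1[OF x] offset_nonneg] rate_nonneg
    by (simp add: mult_left_mono distrib_right)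
  finally show "norm ((residual ^^ n) f x) \<le> (1 + offset) * rate ^ n * V x" by (simp add: mult_ac)
qed

lemma kernel_power_minus_residual_power_compact:
  "compact_operator M V (\<lambda>f x. (PP ^^ n) f x - (residual ^^ n) f x)"
proof (induction n)
  case 0
  show ?case using compact_operator_zero by simp
next
  case (Suc n)
  let ?K = "\<lambda>f x. (PP ^^ n) f x - (residual ^^ n) f x"
  let ?T = "\<lambda>f x. (\<integral>y. f y \<partial>\<nu>) * indicator S x"
  \<comment> \<open>The subtraction from \<open>0\<close> lets closure under differences serve for the sum below.\<close>
  let ?T' = "\<lambda>f x. 0 - ?T f x"
  note Rn = bounded_operator_power[OF residual_bounded, of n]
  note Pn = bounded_operator_power[OF kernel_bounded, of n]
  \<comment> \<open>\<open>P ^^ Suc n - residual ^^ Suc n = P (P ^^ n - residual ^^ n) + (P - residual) residual ^^ n\<close>,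
      where \<open>P - residual\<close> has rank one.\<close>
  have "compact_operator M V (\<lambda>f x. PP (?K f) x - ?T' ((residual ^^ n) f) x)"
    by (rule compact_operator_minus[OF compact_operator_comp_left[OF kernel_bounded Suc]
          compact_operator_comp_right[OF
            compact_operator_minus[OF compact_operator_zero minorant_compact] Rn]])
  then show ?case
  proof (rule compact_operator_cong)
    fix f assume f: "f \<in> wspace M V"
    show "(\<lambda>x. (PP ^^ Suc n) f x - (residual ^^ Suc n) f x)
        = (\<lambda>x. PP (?K f) x - ?T' ((residual ^^ n) f) x)"
      by (simp add: residual_def bounded_operator_diff[OF kernel_bounded
            bounded_operator_wspace[OF Pn f] bounded_operator_wspace[OF Rn f]] algebra_simps)
  qed
qed

lemma kernel_ess_spectral_radius_le: "ess_spectral_radius M V PP \<le> rate"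
proof (rule ess_spectral_radius_le[OF kernel_bounded _ rate_nonneg, where C = "1 + offset"])
  show "0 < 1 + offset" using offset_nonneg by simp
  fix n
  let ?K = "\<lambda>f x. (PP ^^ n) f x - (residual ^^ n) f x"
  have "(\<lambda>f x. (PP ^^ n) f x - ?K f x) = residual ^^ n" by (simp add: fun_eq_iff)
  then show "\<exists>K. compact_operator M V K \<and>
      operator_norm M V (\<lambda>f x. (PP ^^ n) f x - K f x) \<le> (1 + offset) * rate ^ n"
    using kernel_power_minus_residual_power_compact[of n] residual_power_operator_norm_le[of n]
    by (intro exI[of _ ?K]) simp
qed

end

section \<open>Quasi-compactness\<close>

theorem theorem5p2:
  fixes M :: "'a measure" and P :: "'a \<Rightarrow> 'a measure" and V :: "'a \<Rightarrow> real"
    and \<B> :: "'a set set" and S :: "'a set" and \<nu> \<pi> :: "'a measure" and \<delta> L :: real and x\<^sub>0 :: 'a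
  assumes kernel: "P \<in> M \<rightarrow>\<^sub>M prob_algebra M"
    and V_meas: "V \<in> borel_measurable M"
    and V_ge_1: "\<And>x. x \<in> space M \<Longrightarrow> 1 \<le> V x"
    and V_x0: "x\<^sub>0 \<in> space M" "V x\<^sub>0 = 1"
    and PV_bounded: "\<exists>C::real. \<forall>x\<in>space M. (\<integral>\<^sup>+y. ennreal (V y) \<partial>P x) \<le> ennreal (C * V x)"
    and inv_prob: "prob_space \<pi>" "sets \<pi> = sets M" "\<pi> \<bind> P = \<pi>"
    and inv_V: "(\<integral>\<^sup>+x. ennreal (V x) \<partial>\<pi>) < \<infinity>"
    and bornology: "bornology_on (space M) \<B>"
    and S: "S \<in> sets M" "S \<in> \<B>"
    and \<nu>: "sets \<nu> = sets M" "emeasure \<nu> (space M) > 0"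
    and \<delta>: "0 < \<delta>" "\<delta> < 1"
    and L: "L > 0"
    and drift: "\<And>x. x \<in> space M \<Longrightarrow>
      (\<integral>\<^sup>+y. ennreal (V y) \<partial>P x) \<le> ennreal (\<delta> * V x + L * indicator S x)"
    and minorization: "\<And>x A. x \<in> space M \<Longrightarrow> A \<in> sets M \<Longrightarrow>
      emeasure (P x) A \<ge> emeasure \<nu> A * indicator S x"
  shows "power_bounded M V (kernel_operator M P) \<and>
    quasi_compact M V (kernel_operator M P) \<and>
    (let \<tau> = max 0 (L - (\<integral>x. V x \<partial>\<nu>)) in
       ess_spectral_radius M V (kernel_operator M P)
         \<le> (\<delta> * measure \<nu> (space M) + \<tau>) / (measure \<nu> (space M) + \<tau>))"
proof -
  interpret weighted_space M V
    using V_meas V_ge_1 V_x0 by unfold_locales auto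
  have space_\<pi>: "space \<pi> = space M" by (rule sets_eq_imp_space_eq[OF inv_prob(2)])
  have V_\<pi>: "V \<in> borel_measurable \<pi>" using V_meas by (simp cong: measurable_cong_sets add: inv_prob(2))
  \<comment> \<open>Without \<open>S\<close> the drift condition would contract \<open>\<pi>(V)\<close>, which is finite and at least \<open>1\<close>.\<close>
  have "S \<noteq> {}"
  proof
    assume "S = {}"
    interpret \<pi>: prob_space \<pi> by (rule inv_prob(1))
    have V0: "0 \<le> V x" if "x \<in> space \<pi>" for x using V_pos that by (force simp: space_\<pi>)
    have int: "integrable \<pi> V"
      using V0 by (intro integrableI_nonneg V_\<pi> inv_V AE_I2)
    have "P \<in> \<pi> \<rightarrow>\<^sub>M subprob_algebra M"
      using measurable_prob_algebraD[OF kernel] by (simp cong: measurable_cong_sets add: inv_prob(2))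
    then have "(\<integral>\<^sup>+x. ennreal (V x) \<partial>(\<pi> \<bind> P)) = (\<integral>\<^sup>+x. \<integral>\<^sup>+y. ennreal (V y) \<partial>P x \<partial>\<pi>)"
      by (intro nn_integral_bind[where B = M]) (use V_meas in measurable)
    then have "(\<integral>\<^sup>+x. ennreal (V x) \<partial>\<pi>) = (\<integral>\<^sup>+x. \<integral>\<^sup>+y. ennreal (V y) \<partial>P x \<partial>\<pi>)"
      by (simp add: inv_prob(3))
    also have "\<dots> \<le> (\<integral>\<^sup>+x. ennreal (\<delta> * V x) \<partial>\<pi>)"
      using drift \<open>S = {}\<close> by (intro nn_integral_mono) (simp add: space_\<pi>)
    finally have "ennreal (\<integral>x. V x \<partial>\<pi>) \<le> ennreal (\<integral>x. \<delta> * V x \<partial>\<pi>)"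
      using V0 \<delta> int by (simp add: nn_integral_eq_integral AE_I2)
    then have "(\<integral>x. V x \<partial>\<pi>) \<le> \<delta> * (\<integral>x. V x \<partial>\<pi>)"
      using V0 \<delta> by (subst (asm) ennreal_le_iff) (auto intro!: Bochner_Integration.integral_nonneg)
    moreover have "1 \<le> (\<integral>x. V x \<partial>\<pi>)"
      by (intro \<pi>.integral_ge_const int AE_I2) (simp add: space_\<pi> V_ge_1)
    ultimately show False using \<delta> by (simp add: mult_le_cancel_right1)
  qed
  then interpret drift_minorization M V P S \<nu> \<delta> L
    using kernel S \<nu> \<delta> L drift minorization by unfold_locales auto
  show ?thesis
    using kernel_power_bounded kernel_bounded kernel_spectral_radius rate_less_1
      kernel_ess_spectral_radius_le
    by (auto simp: quasi_compact_def Let_def rate_def \<tau>_def)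
qed

end
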